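(* Let $m\in(0,1]$, let $f(q)=\sum_{k=0}^{\infty} q^kp_k\in \mathcal{SB}(\mathbb{B})$, and let $\omega_k\in\mathcal{SB}_k(\mathbb{B})$ for each $k\geq 1$. Let $Q_N(w)=d_1w+d_2w^2+\dots+d_Nw^N$ be a polynomial of degree $N$ with $d_i\geq0$ for $i=1,\dots,N$, whose coefficients satisfy $$L(d_1,\dots,d_N):=8d_1M_m^2+6c_2d_2M_m^4+\dots+2(2N-1)c_Nd_NM_m^{2N}\leq m,\qquad(\ast)$$ where $M_m:=\dfrac{m(2+m)}{4m+4}$ and $c_k:=\max_{x\in[0,1]}\left(x(1+x)^2(1-x^2)^{2k-2}\right)$ for $k=2,3,\dots,N$. Then $$|p_0|^m+\sum_{k=1}^{\infty}|\omega_k(q)p_k|+Q_N\left(S^*_q\right)\leq 1\quad\text{for all } q\text{ with }|q|\leq\frac{m}{2+m},$$ where $S^*_q:=\sum_{k=1}^{\infty}k|q^kp_k|^2$. The constant $m/(2+m)$ is best possible for each $m$ and each $d_1,\dots,d_N$ satisfying $(\ast)$, i.e. for fixed such $m,d_1,\dots,d_N$ it cannot be replaced by any larger number so that the inequality remains true for all such $f$ and $(\omega_k)_{k\ge1}$.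
   Context: $\mathbb{H}$ is the skew field of quaternions with its usual modulus $|\cdot|$; $\mathbb{B}=\{q\in\mathbb{H}:|q|<1\}$ with closure $\overline{\mathbb{B}}$. Let $\mathbb{S}=\{q\in\mathbb{H}:q^2=-1\}$ and, for $I\in\mathbb{S}$, $\mathbb{C}_I=\mathbb{R}\oplus I\mathbb{R}$ and $\mathbb{B}_I=\mathbb{B}\cap\mathbb{C}_I$. A function $f:\mathbb{B}\to\mathbb{H}$ is (left) slice regular if for every $I\in\mathbb{S}$ its restriction $f_I$ to $\mathbb{B}_I$ has continuous partial derivatives and satisfies $\frac12\left(\frac{\partial}{\partial x}+I\frac{\partial}{\partial y}\right)f_I(x+yI)=0$ for all $x+yI\in\mathbb{B}_I$. Every slice regular $f$ on $\mathbb{B}$ has a power series expansion $f(q)=\sum_{k=0}^\infty q^kp_k$ on $\mathbb{B}$ with $p_k\in\mathbb{H}$. The slice derivative $f'$ is defined on each $\mathbb{B}_I$ by $f'(x+yI)=\frac12\left(\frac{\partial}{\partial x}-I\frac{\partial}{\partial y}\right)f_I(x+yI)$; $f^{(j)}$ denotes the $j$-th iterated slice derivative, so $p_k=f^{(k)}(0)/k!$. $\mathcal{SB}(\mathbb{B})$ is the class of slice regular functions $f(q)=\sum_{k=0}^{\infty}q^kp_k$ on $\mathbb{B}$, continuous on $\overline{\mathbb{B}}$, such that $|f(q)|<1$ for all $|q|\leq 1$. For $n\geq1$, $\mathcal{SB}_n(\mathbb{B})$ is the set of $\omega\in\mathcal{SB}(\mathbb{B})$ with $\omega(0)=\omega'(0)=\dots=\omega^{(n-1)}(0)=0$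 but $\omega^{(n)}(0)\neq0$. In the sum $L(d_1,\dots,d_N)$ the first term is $8d_1M_m^2$ and the $k$-th term for $2\le k\le N$ is $2(2k-1)c_kd_kM_m^{2k}$. *)

theory Defs
  imports "HOL-Analysis.Analysis"
begin

datatype quat = Quat (qRe: real) (qIm1: real) (qIm2: real) (qIm3: real)

lemma quat_eq_iff:
  "p = q \<longleftrightarrow> qRe p = qRe q \<and> qIm1 p = qIm1 q \<and> qIm2 p = qIm2 q \<and> qIm3 p = qIm3 q"
  by (auto intro: quat.expand)

instantiation quat :: real_vector
begin

definition zero_quat :: quat where "0 = Quat 0 0 0 0"

definition plus_quat :: "quat \<Rightarrow> quat \<Rightarrow> quat" where
  "p + q = Quat (qRe p + qRe q) (qIm1 p + qIm1 q) (qIm2 p + qIm2 q) (qIm3 p + qIm3 q)"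

definition uminus_quat :: "quat \<Rightarrow> quat" where
  "- p = Quat (- qRe p) (- qIm1 p) (- qIm2 p) (- qIm3 p)"

definition minus_quat :: "quat \<Rightarrow> quat \<Rightarrow> quat" where
  "p - q = Quat (qRe p - qRe q) (qIm1 p - qIm1 q) (qIm2 p - qIm2 q) (qIm3 p - qIm3 q)"

definition scaleR_quat :: "real \<Rightarrow> quat \<Rightarrow> quat" where
  "r *\<^sub>R p = Quat (r * qRe p) (r * qIm1 p) (r * qIm2 p) (r * qIm3 p)"

instance
  by standard
    (simp_all add: quat_eq_iff zero_quat_def plus_quat_def uminus_quat_def minus_quat_def
      scaleR_quat_def algebra_simps)

end

instantiation quat :: real_algebra_1
begin

definition one_quat :: quat where "1 = Quat 1 0 0 0"

definition times_quat :: "quat \<Rightarrow> quat \<Rightarrow> quat" where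
  "p * q = Quat
     (qRe p * qRe q - qIm1 p * qIm1 q - qIm2 p * qIm2 q - qIm3 p * qIm3 q)
     (qRe p * qIm1 q + qIm1 p * qRe q + qIm2 p * qIm3 q - qIm3 p * qIm2 q)
     (qRe p * qIm2 q - qIm1 p * qIm3 q + qIm2 p * qRe q + qIm3 p * qIm1 q)
     (qRe p * qIm3 q + qIm1 p * qIm2 q - qIm2 p * qIm1 q + qIm3 p * qRe q)"

instance
  by standard
    (simp_all add: quat_eq_iff zero_quat_def one_quat_def plus_quat_def times_quat_def
      scaleR_quat_def algebra_simps)

end

instantiation quat :: real_inner
begin

definition inner_quat :: "quat \<Rightarrow> quat \<Rightarrow> real" where
  "p \<bullet> q = qRe p * qRe q + qIm1 p * qIm1 q + qIm2 p * qIm2 q + qIm3 p * qIm3 q"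

definition norm_quat :: "quat \<Rightarrow> real" where
  "norm p = sqrt ((qRe p)\<^sup>2 + (qIm1 p)\<^sup>2 + (qIm2 p)\<^sup>2 + (qIm3 p)\<^sup>2)"

definition sgn_quat_def: "sgn p = p /\<^sub>R norm p" for p :: quat

definition dist_quat_def: "dist p q = norm (p - q)" for p q :: quat

definition uniformity_quat_def:
  "(uniformity :: (quat \<times> quat) filter) = (INF e\<in>{0 <..}. principal {(p, q). dist p q < e})"

definition open_quat_def:
  "open U \<longleftrightarrow> (\<forall>p\<in>U. eventually (\<lambda>(p', q). p' = p \<longrightarrow> q \<in> U) uniformity)"
  for U :: "quat set"

instance
proof
  fix p q r :: quat and a :: real
  show "dist p q = norm (p - q)" by (rule dist_quat_def)
  show "sgn p = p /\<^sub>R norm p" by (rule sgn_quat_def)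
  show "uniformity = (INF e\<in>{0 <..}. principal {(p, q :: quat). dist p q < e})"
    by (rule uniformity_quat_def)
  show "open U \<longleftrightarrow> (\<forall>p\<in>U. eventually (\<lambda>(p', q). p' = p \<longrightarrow> q \<in> U) uniformity)"
    for U :: "quat set" by (rule open_quat_def)
  show "p \<bullet> q = q \<bullet> p" by (simp add: inner_quat_def mult.commute)
  show "(p + q) \<bullet> r = p \<bullet> r + q \<bullet> r"
    by (simp add: inner_quat_def plus_quat_def algebra_simps)
  show "(a *\<^sub>R p) \<bullet> q = a * (p \<bullet> q)"
    by (simp add: inner_quat_def scaleR_quat_def algebra_simps)
  show "0 \<le> p \<bullet> p" by (simp add: inner_quat_def)
  show "p \<bullet> p = 0 \<longleftrightarrow> p = 0"
    by (auto simp: inner_quat_def zero_quat_def quat_eq_iff add_nonneg_eq_0_iff)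
  show "norm p = sqrt (p \<bullet> p)"
    by (simp add: inner_quat_def norm_quat_def power2_eq_square)
qed

end

instantiation quat :: euclidean_space
begin

definition Basis_quat :: "quat set" where
  "Basis = {Quat 1 0 0 0, Quat 0 1 0 0, Quat 0 0 1 0, Quat 0 0 0 1}"

instance
proof
  show "(Basis :: quat set) \<noteq> {}" "finite (Basis :: quat set)"
    by (simp_all add: Basis_quat_def)
  show "u \<bullet> v = (if u = v then 1 else 0)" if "u \<in> Basis" "v \<in> Basis" for u v :: quat
    using that unfolding Basis_quat_def by (elim insertE emptyE) (simp_all add: inner_quat_def)
  show "(\<forall>u\<in>Basis. p \<bullet> u = 0) \<longleftrightarrow> p = 0" for p :: quat
    unfolding quat_eq_iff[of p] by (simp add: Basis_quat_def inner_quat_def zero_quat_def)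
qed

end

instantiation quat :: real_normed_div_algebra
begin

definition inverse_quat :: "quat \<Rightarrow> quat" where
  "inverse p = Quat (qRe p) (- qIm1 p) (- qIm2 p) (- qIm3 p) /\<^sub>R (norm p)\<^sup>2"

definition divide_quat_def: "p div q = p * inverse q" for p q :: quat

instance
proof
  fix p q :: quat
  have n2: "(norm x)\<^sup>2 = (qRe x)\<^sup>2 + (qIm1 x)\<^sup>2 + (qIm2 x)\<^sup>2 + (qIm3 x)\<^sup>2" for x :: quat
    by (simp add: norm_quat_def)
  show "p div q = p * inverse q" by (rule divide_quat_def)
  show "inverse (0::quat) = 0"
    by (simp add: inverse_quat_def norm_quat_def zero_quat_def scaleR_quat_def)
  let ?c = "Quat (qRe p) (- qIm1 p) (- qIm2 p) (- qIm3 p)"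
  have "?c * p = (norm p)\<^sup>2 *\<^sub>R 1" "p * ?c = (norm p)\<^sup>2 *\<^sub>R 1"
    unfolding n2
    by (simp_all add: quat_eq_iff times_quat_def one_quat_def scaleR_quat_def power2_eq_square)
  then show "inverse p * p = 1" "p * inverse p = 1" if "p \<noteq> 0"
    using that by (simp_all add: inverse_quat_def)
  have "(norm (p * q))\<^sup>2 = (norm p * norm q)\<^sup>2"
    unfolding power_mult_distrib n2
    by (simp add: times_quat_def power2_eq_square algebra_simps)
  then show "norm (p * q) = norm p * norm q"
    by (simp add: power2_eq_iff_nonneg)
qed

end

definition imag_units :: "quat set" where
  "imag_units = {q. q\<^sup>2 = -1}"

definition slice_pt :: "quat \<Rightarrow> real \<Rightarrow> real \<Rightarrow> quat" where
  "slice_pt I x y = of_real x + of_real y * I"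

definition slice_dx :: "quat \<Rightarrow> (quat \<Rightarrow> quat) \<Rightarrow> real \<Rightarrow> real \<Rightarrow> quat" where
  "slice_dx I f x y = vector_derivative (\<lambda>t. f (slice_pt I t y)) (at x)"

definition slice_dy :: "quat \<Rightarrow> (quat \<Rightarrow> quat) \<Rightarrow> real \<Rightarrow> real \<Rightarrow> quat" where
  "slice_dy I f x y = vector_derivative (\<lambda>t. f (slice_pt I x t)) (at y)"

definition slice_disc :: "quat \<Rightarrow> (real \<times> real) set" where
  "slice_disc I = {(x, y). slice_pt I x y \<in> ball 0 1}"

text \<open>
  Functions on the unit ball are total functions \<^typ>\<open>quat \<Rightarrow> quat\<close>; their values outside
  the (open or closed) ball are irrelevant.
\<close>

definition slice_regular :: "(quat \<Rightarrow> quat) \<Rightarrow> bool" where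
  "slice_regular f \<longleftrightarrow>
     (\<forall>I\<in>imag_units.
        (\<forall>(x, y)\<in>slice_disc I.
           (\<lambda>t. f (slice_pt I t y)) differentiable (at x) \<and>
           (\<lambda>t. f (slice_pt I x t)) differentiable (at y)) \<and>
        continuous_on (slice_disc I) (\<lambda>(x, y). slice_dx I f x y) \<and>
        continuous_on (slice_disc I) (\<lambda>(x, y). slice_dy I f x y) \<and>
        (\<forall>(x, y)\<in>slice_disc I. (1/2) *\<^sub>R (slice_dx I f x y + I * slice_dy I f x y) = 0))"

text \<open>
  A non-real \<open>q\<close> is \<open>x + yI\<close> for exactly two triples \<open>(I, x, y)\<close> and \<open>(-I, x, -y)\<close>, which give
  the same value below. A real \<open>q\<close> is \<open>q + 0I\<close> for every imaginary unit \<open>I\<close>; there the value is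
  independent of \<open>I\<close> whenever \<open>f\<close> is slice regular, being the derivative of \<open>f\<close> along the
  real axis.
\<close>

definition slice_deriv :: "(quat \<Rightarrow> quat) \<Rightarrow> quat \<Rightarrow> quat" where
  "slice_deriv f q =
     (let (I, x, y) = (SOME (I, x, y). I \<in> imag_units \<and> q = slice_pt I x y)
      in (1/2) *\<^sub>R (slice_dx I f x y - I * slice_dy I f x y))"

definition SB :: "(quat \<Rightarrow> quat) set" where
  "SB = {f. slice_regular f \<and> continuous_on (cball 0 1) f \<and> (\<forall>q\<in>cball 0 1. norm (f q) < 1)}"

definition SB_ord :: "nat \<Rightarrow> (quat \<Rightarrow> quat) set" where
  "SB_ord n =
     {\<omega> \<in> SB. (\<forall>j<n. (slice_deriv ^^ j) \<omega> 0 = 0) \<and> (slice_deriv ^^ n) \<omega> 0 \<noteq> 0}"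

definition has_power_series :: "(quat \<Rightarrow> quat) \<Rightarrow> (nat \<Rightarrow> quat) \<Rightarrow> bool" where
  "has_power_series f p \<longleftrightarrow> (\<forall>q\<in>ball 0 1. (\<lambda>k. q ^ k * p k) sums f q)"

definition M_const :: "real \<Rightarrow> real" where
  "M_const m = m * (2 + m) / (4 * m + 4)"

definition c_const :: "nat \<Rightarrow> real" where
  "c_const k = (GREATEST v. v \<in> (\<lambda>x. x * (1 + x)\<^sup>2 * (1 - x\<^sup>2) ^ (2 * k - 2)) ` {0..1})"

text \<open>The maximum defining \<^const>\<open>c_const\<close> is attained, so \<^const>\<open>Greatest\<close> is meaningful here.\<close>

lemma c_const_is_max:
  defines "g \<equiv> \<lambda>k (x::real). x * (1 + x)\<^sup>2 * (1 - x\<^sup>2) ^ (2 * k - 2)"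
  shows "c_const k \<in> g k ` {0..1}" "x \<in> {0..1} \<Longrightarrow> g k x \<le> c_const k"
proof -
  have "continuous_on {0..1} (g k)"
    unfolding g_def by (intro continuous_intros)
  then obtain x0 where x0: "x0 \<in> {0..1}" "\<forall>x\<in>{0..1}. g k x \<le> g k x0"
    using continuous_attains_sup[of "{0..1::real}" "g k"] by auto
  then have "c_const k = g k x0"
    unfolding c_const_def g_def by (intro Greatest_equality) auto
  with x0 show "c_const k \<in> g k ` {0..1}" "x \<in> {0..1} \<Longrightarrow> g k x \<le> c_const k"
    by auto
qed

definition L_sum :: "real \<Rightarrow> nat \<Rightarrow> (nat \<Rightarrow> real) \<Rightarrow> real" where
  "L_sum m N d =
     8 * d 1 * (M_const m)\<^sup>2 +
     (\<Sum>k=2..N. 2 * (2 * real k - 1) * c_const k * d k * M_const m ^ (2 * k))"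

definition Q_poly :: "nat \<Rightarrow> (nat \<Rightarrow> real) \<Rightarrow> real poly" where
  "Q_poly N d = (\<Sum>i=1..N. monom (d i) i)"

text \<open>The series over \<open>k \<ge> 1\<close> below are indexed by \<^const>\<open>Suc\<close>.\<close>

definition S_star :: "(nat \<Rightarrow> quat) \<Rightarrow> quat \<Rightarrow> real" where
  "S_star p q = (\<Sum>k. real (Suc k) * (norm (q ^ Suc k * p (Suc k)))\<^sup>2)"

definition bohr_summable :: "(nat \<Rightarrow> quat) \<Rightarrow> (nat \<Rightarrow> quat \<Rightarrow> quat) \<Rightarrow> quat \<Rightarrow> bool" where
  "bohr_summable p \<omega> q \<longleftrightarrow>
     summable (\<lambda>k. norm (\<omega> (Suc k) q * p (Suc k))) \<and>
     summable (\<lambda>k. real (Suc k) * (norm (q ^ Suc k * p (Suc k)))\<^sup>2)"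

definition bohr_sum ::
  "real \<Rightarrow> nat \<Rightarrow> (nat \<Rightarrow> real) \<Rightarrow> (nat \<Rightarrow> quat) \<Rightarrow> (nat \<Rightarrow> quat \<Rightarrow> quat) \<Rightarrow> quat \<Rightarrow> real" where
  "bohr_sum m N d p \<omega> q =
     norm (p 0) powr m + (\<Sum>k. norm (\<omega> (Suc k) q * p (Suc k))) + poly (Q_poly N d) (S_star p q)"

end

theory Submission
  imports Defs "HOL-Complex_Analysis.Complex_Analysis"
begin

text \<open>
  The projection of the quaternions to a slice, composed with a right rotation of the values,
  turns a slice regular function into a holomorphic function on the unit disc. With suitably
  chosen slice and rotation nothing is lost at a given point or coefficient, so the Schwarz lemma
  \<open>\<bar>\<omega>\<^sub>k(q)\<bar> \<le> \<bar>q\<bar>\<^sup>k\<close> and the coefficient bound \<open>\<bar>p\<^sub>k\<bar> \<le> 1 - a\<^sup>2\<close> with \<open>a = \<bar>p\<^sub>0\<bar>\<close> reduce to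
  the complex case. For \<open>\<bar>q\<bar> \<le> m / (2 + m)\<close> the first series is then at most \<open>(1 - a\<^sup>2) m / 2\<close> and
  the argument of \<open>Q\<^sub>N\<close> at most \<open>((1 - a\<^sup>2) M\<^sub>m)\<^sup>2\<close>, which leaves an inequality in \<open>a\<close> alone.
  Sharpness comes from \<open>\<rho> (a - q) (1 - a q)\<^sup>-\<^sup>1\<close> and \<open>\<omega>\<^sub>k(q) = \<rho> q\<^sup>k\<close> at a real point \<open>q\<close>, with
  \<open>a\<close> and \<open>\<rho>\<close> close to 1; the factor \<open>\<rho>\<close> is there because \<^const>\<open>SB\<close> demands modulus strictly
  less than 1 on the closed ball.
\<close>

section \<open>Slices of the quaternions\<close>

lemma qRe_simps [simp]:
  "qRe (x + y) = qRe x + qRe y" "qRe (x - y) = qRe x - qRe y" "qRe (- x) = - qRe x"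
  "qRe (r *\<^sub>R x) = r * qRe x" "qRe 0 = 0" "qRe 1 = 1" "qRe (of_real r) = r"
  by (simp_all add: plus_quat_def minus_quat_def uminus_quat_def scaleR_quat_def zero_quat_def
      one_quat_def of_real_def)

lemma qIm_simps [simp]:
  "qIm1 (x + y) = qIm1 x + qIm1 y" "qIm1 (x - y) = qIm1 x - qIm1 y" "qIm1 (- x) = - qIm1 x"
  "qIm1 (r *\<^sub>R x) = r * qIm1 x" "qIm1 0 = 0" "qIm1 1 = 0" "qIm1 (of_real r) = 0"
  "qIm2 (x + y) = qIm2 x + qIm2 y" "qIm2 (x - y) = qIm2 x - qIm2 y" "qIm2 (- x) = - qIm2 x"
  "qIm2 (r *\<^sub>R x) = r * qIm2 x" "qIm2 0 = 0" "qIm2 1 = 0" "qIm2 (of_real r) = 0"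
  "qIm3 (x + y) = qIm3 x + qIm3 y" "qIm3 (x - y) = qIm3 x - qIm3 y" "qIm3 (- x) = - qIm3 x"
  "qIm3 (r *\<^sub>R x) = r * qIm3 x" "qIm3 0 = 0" "qIm3 1 = 0" "qIm3 (of_real r) = 0"
  by (simp_all add: plus_quat_def minus_quat_def uminus_quat_def scaleR_quat_def zero_quat_def
      one_quat_def of_real_def)

text \<open>The imaginary components of \<open>I * I\<close> are those of \<open>I\<close> times
  twice \<open>qRe I\<close>. With \<open>qRe I\<close> nonzero, \<open>I\<close> would be real and
  its square not negative.\<close>

lemma imag_units_iff:
  "I \<in> imag_units \<longleftrightarrow> qRe I = 0 \<and> (qIm1 I)\<^sup>2 + (qIm2 I)\<^sup>2 + (qIm3 I)\<^sup>2 = 1"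
proof
  assume "I \<in> imag_units"
  then have sq: "I * I = -1"
    by (simp add: imag_units_def power2_eq_square)
  then have eqs: "qRe I * qRe I - qIm1 I * qIm1 I - qIm2 I * qIm2 I - qIm3 I * qIm3 I = -1"
    "qRe I * qIm1 I = 0" "qRe I * qIm2 I = 0" "qRe I * qIm3 I = 0"
    by (auto simp: quat_eq_iff times_quat_def algebra_simps)
  have "qRe I = 0"
  proof (rule ccontr)
    assume "qRe I \<noteq> 0"
    with eqs have "qRe I * qRe I = -1" by simp
    then show False
      using zero_le_square[of "qRe I"] by linarith
  qed
  with eqs show "qRe I = 0 \<and> (qIm1 I)\<^sup>2 + (qIm2 I)\<^sup>2 + (qIm3 I)\<^sup>2 = 1"
    by (simp add: power2_eq_square)
next
  assume "qRe I = 0 \<and> (qIm1 I)\<^sup>2 + (qIm2 I)\<^sup>2 + (qIm3 I)\<^sup>2 = 1"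
  then show "I \<in> imag_units"
    by (simp add: imag_units_def power2_eq_square quat_eq_iff times_quat_def)
qed

lemma imag_units_square: "I \<in> imag_units \<Longrightarrow> I * I = -1"
  by (simp add: imag_units_def power2_eq_square)

definition quat_cnj :: "quat \<Rightarrow> quat" where
  "quat_cnj p = Quat (qRe p) (- qIm1 p) (- qIm2 p) (- qIm3 p)"

lemma mult_quat_cnj: "p * quat_cnj p = of_real ((norm p)\<^sup>2)"
  by (simp add: quat_eq_iff quat_cnj_def times_quat_def norm_quat_def power2_eq_square)

lemma norm_quat_cnj [simp]: "norm (quat_cnj p) = norm p"
  by (simp add: norm_quat_def quat_cnj_def)

lemma inner_quat_conv_cnj: "p \<bullet> q = qRe (p * quat_cnj q)"
  by (simp add: inner_quat_def quat_cnj_def times_quat_def)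

text \<open>Power series have their coefficients on the right, so right multiplication by a unit is
  harmless. It moves a value or a coefficient to the nonnegative real axis, which lies in every
  slice.\<close>

lemma ex_unit_rotation_to_norm:
  fixes p :: quat
  obtains u where "norm u = 1" "p * u = of_real (norm p)"
proof (cases "p = 0")
  case True
  then show ?thesis using that[of 1] by simp
next
  case False
  have "p * (quat_cnj p /\<^sub>R norm p) = of_real (norm p)"
    using False unfolding mult_scaleR_right mult_quat_cnj
    by (simp add: scaleR_conv_of_real power2_eq_square flip: of_real_mult of_real_inverse)
  moreover have "norm (quat_cnj p /\<^sub>R norm p) = 1"
    using False by simp
  ultimately show ?thesis using that by blast
qed

text \<open>For an imaginary unit \<open>I\<close> this is the field isomorphism of the complex
  plane onto the slice of \<open>I\<close>.\<close>

definition slice_embed :: "quat \<Rightarrow> complex \<Rightarrow> quat" where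
  "slice_embed I z = slice_pt I (Re z) (Im z)"

text \<open>For an imaginary unit \<open>I\<close> this is the orthogonal projection to the slice
  with orthonormal basis 1 and \<open>I\<close>, read as a complex number.\<close>

definition slice_proj :: "quat \<Rightarrow> quat \<Rightarrow> complex" where
  "slice_proj I q = Complex (qRe q) (q \<bullet> I)"

lemma slice_pt_eq_embed: "slice_pt I x y = slice_embed I (Complex x y)"
  by (simp add: slice_embed_def)

lemma slice_embed_of_real [simp]: "slice_embed I (of_real r) = of_real r"
  by (simp add: slice_embed_def slice_pt_def)

lemma slice_embed_0 [simp]: "slice_embed I 0 = 0"
  and slice_embed_1 [simp]: "slice_embed I 1 = 1"
  and slice_embed_ii [simp]: "slice_embed I \<i> = I"
  by (simp_all add: slice_embed_def slice_pt_def)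

lemma slice_embed_add: "slice_embed I (z + w) = slice_embed I z + slice_embed I w"
  by (simp add: slice_embed_def slice_pt_def algebra_simps)

lemma slice_embed_scaleR: "slice_embed I (r *\<^sub>R z) = r *\<^sub>R slice_embed I z"
  by (simp add: slice_embed_def slice_pt_def scaleR_conv_of_real algebra_simps)

lemma slice_embed_mult:
  assumes "I \<in> imag_units"
  shows "slice_embed I (z * w) = slice_embed I z * slice_embed I w"
proof -
  have r: "qRe I = 0" and n: "qIm1 I * qIm1 I + qIm2 I * qIm2 I + qIm3 I * qIm3 I = 1"
    using assms by (auto simp: imag_units_iff power2_eq_square)
  \<comment> \<open>Only the real part depends on \<open>I\<close> having modulus 1; in the
    imaginary components the cross terms cancel.\<close>
  have "qRe (slice_embed I z * slice_embed I w)
      = Re z * Re w - (Im z * Im w) * (qIm1 I * qIm1 I + qIm2 I * qIm2 I + qIm3 I * qIm3 I)"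
    by (simp add: slice_embed_def slice_pt_def times_quat_def r algebra_simps)
  then have "qRe (slice_embed I z * slice_embed I w) = qRe (slice_embed I (z * w))"
    unfolding n by (simp add: slice_embed_def slice_pt_def times_quat_def r)
  then show ?thesis
    by (simp add: quat_eq_iff)
       (simp add: slice_embed_def slice_pt_def times_quat_def r algebra_simps)
qed

lemma slice_embed_power:
  "I \<in> imag_units \<Longrightarrow> slice_embed I (z ^ k) = slice_embed I z ^ k"
  by (induction k) (simp_all add: slice_embed_mult)

lemma norm_slice_embed:
  assumes "I \<in> imag_units"
  shows "norm (slice_embed I z) = norm z"
proof -
  have "qRe I = 0" and n: "(qIm1 I)\<^sup>2 + (qIm2 I)\<^sup>2 + (qIm3 I)\<^sup>2 = 1"
    using assms by (auto simp: imag_units_iff)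
  have "(Im z * qIm1 I)\<^sup>2 + (Im z * qIm2 I)\<^sup>2 + (Im z * qIm3 I)\<^sup>2
      = (Im z)\<^sup>2 * ((qIm1 I)\<^sup>2 + (qIm2 I)\<^sup>2 + (qIm3 I)\<^sup>2)"
    by (simp add: power_mult_distrib algebra_simps)
  with n \<open>qRe I = 0\<close> show ?thesis
    by (simp add: norm_quat_def cmod_def slice_embed_def slice_pt_def times_quat_def add.assoc)
qed

lemma slice_embed_inverse:
  assumes "I \<in> imag_units"
  shows "slice_embed I (inverse z) = inverse (slice_embed I z)"
proof (cases "z = 0")
  case False
  then have "slice_embed I z * slice_embed I (inverse z) = 1"
    using slice_embed_mult[OF assms, of z "inverse z"] by simp
  then show ?thesis by (rule inverse_unique[symmetric])
qed simp

lemma bounded_linear_slice_embed: "bounded_linear (slice_embed I)"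
  by (intro linear_conv_bounded_linear[THEN iffD1] linearI slice_embed_add slice_embed_scaleR)

lemma bounded_linear_slice_proj: "bounded_linear (slice_proj I)"
  by (intro linear_conv_bounded_linear[THEN iffD1] linearI)
     (simp_all add: slice_proj_def complex_eq_iff inner_add_left)

text \<open>Left multiplication by slice elements preserves the slice and its orthogonal complement,
  so the projection is complex linear. This turns left slice regularity into holomorphy.\<close>

lemma slice_proj_embed_mult:
  assumes "I \<in> imag_units"
  shows "slice_proj I (slice_embed I z * q) = z * slice_proj I q"
proof -
  have r: "qRe I = 0" and n: "(qIm1 I)\<^sup>2 + (qIm2 I)\<^sup>2 + (qIm3 I)\<^sup>2 = 1"
    using assms by (auto simp: imag_units_iff)
  have "(slice_embed I z * q) \<bullet> I = Im z * qRe q * ((qIm1 I)\<^sup>2 + (qIm2 I)\<^sup>2 + (qIm3 I)\<^sup>2)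
      + Re z * (q \<bullet> I)"
    by (simp add: slice_embed_def slice_pt_def times_quat_def inner_quat_def r power2_eq_square
        algebra_simps)
  with n have "(slice_embed I z * q) \<bullet> I = Im z * qRe q + Re z * (q \<bullet> I)"
    by simp
  moreover have "qRe (slice_embed I z * q) = Re z * qRe q - Im z * (q \<bullet> I)"
    by (simp add: slice_embed_def slice_pt_def times_quat_def inner_quat_def r algebra_simps)
  ultimately show ?thesis
    by (simp add: slice_proj_def complex_eq_iff)
qed

lemma slice_proj_embed:
  assumes "I \<in> imag_units"
  shows "slice_proj I (slice_embed I z) = z"
proof -
  have "slice_proj I 1 = 1"
    using assms by (simp add: slice_proj_def imag_units_iff inner_quat_def one_complex.code)
  then show ?thesis
    using slice_proj_embed_mult[OF assms, of z 1] by simp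
qed

lemma norm_slice_proj_le:
  assumes "I \<in> imag_units"
  shows "norm (slice_proj I q) \<le> norm q"
proof -
  have II: "I \<bullet> I = 1" "(1::quat) \<bullet> 1 = 1" "I \<bullet> 1 = 0" "1 \<bullet> I = 0" "I \<bullet> q = q \<bullet> I" "1 \<bullet> q = q \<bullet> 1"
    using assms by (simp_all add: imag_units_iff inner_quat_def power2_eq_square)
  \<comment> \<open>Bessel's inequality for the orthonormal pair 1 and \<open>I\<close>.\<close>
  have "0 \<le> (q - (q \<bullet> 1) *\<^sub>R 1 - (q \<bullet> I) *\<^sub>R I) \<bullet> (q - (q \<bullet> 1) *\<^sub>R 1 - (q \<bullet> I) *\<^sub>R I)"
    by (rule inner_ge_zero)
  also have "\<dots> = q \<bullet> q - (q \<bullet> 1)\<^sup>2 - (q \<bullet> I)\<^sup>2"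
    by (simp add: inner_diff_left inner_diff_right II power2_eq_square)
  finally have "(qRe q)\<^sup>2 + (q \<bullet> I)\<^sup>2 \<le> (norm q)\<^sup>2"
    by (simp add: power2_norm_eq_inner inner_quat_def)
  then show ?thesis
    by (simp add: slice_proj_def cmod_def real_le_lsqrt)
qed

text \<open>Off the real axis \<open>I\<close> is the normalised imaginary part of \<open>q\<close>.
  A real \<open>q\<close> lies in every slice, so any unit serves.\<close>

lemma ex_slice_embed:
  obtains I z where "I \<in> imag_units" "q = slice_embed I z"
proof (cases "qIm1 q = 0 \<and> qIm2 q = 0 \<and> qIm3 q = 0")
  case True
  then have "q = slice_embed (Quat 0 1 0 0) (of_real (qRe q))"
    unfolding slice_embed_of_real by (simp add: quat_eq_iff)
  moreover have "Quat 0 1 0 0 \<in> imag_units"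
    by (simp add: imag_units_iff)
  ultimately show ?thesis using that by blast
next
  case False
  define s where "s = sqrt ((qIm1 q)\<^sup>2 + (qIm2 q)\<^sup>2 + (qIm3 q)\<^sup>2)"
  have pos: "(qIm1 q)\<^sup>2 + (qIm2 q)\<^sup>2 + (qIm3 q)\<^sup>2 > 0"
    using False by (metis add_nonneg_eq_0_iff add_nonneg_nonneg less_eq_real_def power_eq_0_iff zero_le_power2)
  then have "s > 0" and s2: "s\<^sup>2 = (qIm1 q)\<^sup>2 + (qIm2 q)\<^sup>2 + (qIm3 q)\<^sup>2"
    unfolding s_def by (simp_all)
  let ?I = "Quat 0 (qIm1 q / s) (qIm2 q / s) (qIm3 q / s)"
  have "?I \<in> imag_units"
    using \<open>s > 0\<close> by (simp add: imag_units_iff power_divide flip: s2 add_divide_distrib)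
  moreover have "q = slice_embed ?I (Complex (qRe q) s)"
    using \<open>s > 0\<close> by (simp add: quat_eq_iff slice_embed_def slice_pt_def times_quat_def)
  ultimately show ?thesis using that by blast
qed

text \<open>One projection forgets two real dimensions, but right rotations recover them: for
  \<open>u = quat_cnj q\<close> the real part is the squared norm.\<close>

lemma quat_eq_0_if_slice_proj:
  assumes "I \<in> imag_units" and "\<And>u. slice_proj I (q * u) = 0"
  shows "q = 0"
proof -
  have "qRe (q * quat_cnj q) = 0"
    using assms(2)[of "quat_cnj q"] by (simp add: slice_proj_def complex_eq_iff)
  then have "(norm q)\<^sup>2 = 0"
    unfolding mult_quat_cnj qRe_simps .
  then show ?thesis by simp
qed

section \<open>Slice derivatives\<close>

text \<open>Asking the real derivative to be left multiplication of \<open>D z\<close> by the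
  increment packs differentiability and the Cauchy-Riemann equation into one condition.\<close>

definition has_slice_deriv :: "quat \<Rightarrow> (quat \<Rightarrow> quat) \<Rightarrow> (complex \<Rightarrow> quat) \<Rightarrow> bool" where
  "has_slice_deriv I f D \<longleftrightarrow>
     (\<forall>z\<in>ball 0 1. ((\<lambda>z. f (slice_embed I z)) has_derivative (\<lambda>h. slice_embed I h * D z)) (at z))"

text \<open>The property that is carried along when slice derivatives are iterated.\<close>

definition slice_holomorphic :: "(quat \<Rightarrow> quat) \<Rightarrow> bool" where
  "slice_holomorphic f \<longleftrightarrow> (\<forall>I\<in>imag_units. \<exists>D. has_slice_deriv I f D)"

lemma slice_disc_iff:
  "I \<in> imag_units \<Longrightarrow> (x, y) \<in> slice_disc I \<longleftrightarrow> Complex x y \<in> ball 0 1"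
  by (simp add: slice_disc_def slice_pt_eq_embed norm_slice_embed)

lemma has_vector_derivative_slice:
  assumes "has_slice_deriv I f D" and "Complex x y \<in> ball 0 1"
  shows "((\<lambda>t. f (slice_pt I t y)) has_vector_derivative D (Complex x y)) (at x)"
    and "((\<lambda>t. f (slice_pt I x t)) has_vector_derivative I * D (Complex x y)) (at y)"
proof -
  have *: "((\<lambda>z. f (slice_embed I z)) has_derivative (\<lambda>h. slice_embed I h * D (Complex x y)))
      (at (Complex x y))"
    using assms by (auto simp: has_slice_deriv_def)
  have "((\<lambda>t. Complex t y) has_derivative of_real) (at x)"
    unfolding Complex_eq by (auto intro!: derivative_eq_intros)
  from has_derivative_compose[OF this *]
  show "((\<lambda>t. f (slice_pt I t y)) has_vector_derivative D (Complex x y)) (at x)"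
    by (simp add: has_vector_derivative_def slice_pt_eq_embed scaleR_conv_of_real)
  have "((\<lambda>t. Complex x t) has_derivative (\<lambda>s. s *\<^sub>R \<i>)) (at y)"
    unfolding Complex_eq by (auto intro!: derivative_eq_intros simp: scaleR_conv_of_real)
  from has_derivative_compose[OF this *]
  show "((\<lambda>t. f (slice_pt I x t)) has_vector_derivative I * D (Complex x y)) (at y)"
    by (simp add: has_vector_derivative_def slice_pt_eq_embed slice_embed_scaleR)
qed

lemma slice_partials:
  assumes "has_slice_deriv I f D" and "Complex x y \<in> ball 0 1"
  shows "slice_dx I f x y = D (Complex x y)" and "slice_dy I f x y = I * D (Complex x y)"
  using has_vector_derivative_slice[OF assms]
  by (simp_all add: slice_dx_def slice_dy_def vector_derivative_at)

text \<open>The derivative in \<open>y\<close> is \<open>I\<close> times that in \<open>x\<close>,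
  so the Cauchy-Riemann equation reduces to \<open>I * I = -1\<close>.\<close>

lemma slice_regularI:
  assumes "\<And>I. I \<in> imag_units \<Longrightarrow> \<exists>D. has_slice_deriv I f D \<and> continuous_on (ball 0 1) D"
  shows "slice_regular f"
  unfolding slice_regular_def
proof (intro ballI)
  fix I assume I: "I \<in> imag_units"
  then obtain D where D: "has_slice_deriv I f D" and cont: "continuous_on (ball 0 1) D"
    using assms by blast
  have in_ball: "Complex x y \<in> ball 0 1" if "(x, y) \<in> slice_disc I" for x y
    using that I slice_disc_iff by blast
  have "continuous_on (slice_disc I) (\<lambda>p. Complex (fst p) (snd p))"
    by (intro continuous_intros)
  then have cont': "continuous_on (slice_disc I) (\<lambda>p. D (Complex (fst p) (snd p)))"
    by (rule continuous_on_compose2[OF cont]) (use in_ball in auto)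
  have "continuous_on (slice_disc I) (\<lambda>(x, y). slice_dx I f x y)"
    using cont' by (rule continuous_on_eq) (auto simp: slice_partials(1)[OF D in_ball])
  moreover have "continuous_on (slice_disc I) (\<lambda>(x, y). slice_dy I f x y)"
    using continuous_on_mult[OF continuous_on_const[of _ I] cont']
    by (rule continuous_on_eq) (auto simp: slice_partials(2)[OF D in_ball])
  moreover have "(\<lambda>t. f (slice_pt I t y)) differentiable (at x)"
    "(\<lambda>t. f (slice_pt I x t)) differentiable (at y)"
    "(1/2) *\<^sub>R (slice_dx I f x y + I * slice_dy I f x y) = 0"
    if "(x, y) \<in> slice_disc I" for x y
  proof -
    note xy = in_ball[OF that]
    show "(\<lambda>t. f (slice_pt I t y)) differentiable (at x)"
      "(\<lambda>t. f (slice_pt I x t)) differentiable (at y)"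
      using has_vector_derivative_slice[OF D xy] by (auto intro: differentiableI_vector)
    show "(1/2) *\<^sub>R (slice_dx I f x y + I * slice_dy I f x y) = 0"
      by (simp add: slice_partials[OF D xy] imag_units_square[OF I] flip: mult.assoc)
  qed
  ultimately show "(\<forall>(x, y)\<in>slice_disc I.
           (\<lambda>t. f (slice_pt I t y)) differentiable (at x) \<and>
           (\<lambda>t. f (slice_pt I x t)) differentiable (at y)) \<and>
        continuous_on (slice_disc I) (\<lambda>(x, y). slice_dx I f x y) \<and>
        continuous_on (slice_disc I) (\<lambda>(x, y). slice_dy I f x y) \<and>
        (\<forall>(x, y)\<in>slice_disc I. (1/2) *\<^sub>R (slice_dx I f x y + I * slice_dy I f x y) = 0)"
    by blast
qed

text \<open>Continuity of the partial derivatives yields a total real derivative, which the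
  Cauchy-Riemann equation makes linear over the slice.\<close>

lemma slice_regular_imp_has_slice_deriv:
  assumes f: "slice_regular f" and I: "I \<in> imag_units"
  shows "has_slice_deriv I f (\<lambda>z. slice_dx I f (Re z) (Im z))"
  unfolding has_slice_deriv_def
proof
  fix z :: complex assume z: "z \<in> ball 0 1"
  define x y where "x = Re z" and "y = Im z"
  have xy: "(x, y) \<in> slice_disc I"
    using z by (simp add: slice_disc_iff[OF I] x_def y_def)
  have diff: "((\<lambda>t. f (slice_pt I t y')) has_vector_derivative slice_dx I f x' y') (at x')"
    "((\<lambda>t. f (slice_pt I x' t)) has_vector_derivative slice_dy I f x' y') (at y')"
    "(1/2) *\<^sub>R (slice_dx I f x' y' + I * slice_dy I f x' y') = 0"
    if "(x', y') \<in> slice_disc I" for x' y'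
    using f I that unfolding slice_regular_def slice_dx_def slice_dy_def
    by (auto simp: vector_derivative_works)
  have cont: "continuous_on (slice_disc I) (\<lambda>(x, y). slice_dy I f x y)"
    using f I unfolding slice_regular_def by blast
  have "slice_disc I = (\<lambda>p. Complex (fst p) (snd p)) -` ball 0 1"
    using slice_disc_iff[OF I] by auto
  then have op: "open (slice_disc I)"
    by (auto intro!: open_vimage continuous_intros)
  \<comment> \<open>The criterion for total differentiability works on a product with convex second
    factor, so a rectangle around the point is cut out.\<close>
  then obtain A B where AB: "open A" "open B" "x \<in> A" "y \<in> B" "A \<times> B \<subseteq> slice_disc I"
    using xy by (rule open_prod_elim) auto
  obtain e where e: "e > 0" "ball y e \<subseteq> B"
    using AB open_contains_ball by blast
  define Y where "Y = ball y e"
  have Y: "open Y" "convex Y" "y \<in> Y" "A \<times> Y \<subseteq> slice_disc I"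
    using e AB by (auto simp: Y_def)
  have "continuous (at (x, y)) (\<lambda>(x, y). slice_dy I f x y)"
    using cont op xy by (simp add: continuous_on_eq_continuous_at)
  then have "continuous (at (x, y)) (\<lambda>p. blinfun_scaleR_left (case p of (x, y) \<Rightarrow> slice_dy I f x y))"
    by (rule bounded_linear.continuous[OF bounded_linear_blinfun_scaleR_left])
  then have cont': "continuous (at (x, y) within A \<times> Y)
      (\<lambda>(x, y). blinfun_scaleR_left (slice_dy I f x y))"
    by (simp add: case_prod_beta' continuous_at_imp_continuous_at_within)
  have "((\<lambda>(x, y). f (slice_pt I x y)) has_derivative
      (\<lambda>(tx, ty). tx *\<^sub>R slice_dx I f x y + blinfun_scaleR_left (slice_dy I f x y) ty))
      (at (x, y) within A \<times> Y)"
  proof (rule has_derivative_partialsI[where fy = "\<lambda>x y. blinfun_scaleR_left (slice_dy I f x y)"])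
    show "((\<lambda>x. f (slice_pt I x y)) has_derivative (\<lambda>tx. tx *\<^sub>R slice_dx I f x y)) (at x within A)"
      using diff(1)[OF xy] by (simp add: has_vector_derivative_def has_derivative_at_withinI)
    show "((\<lambda>y. f (slice_pt I x' y)) has_derivative blinfun_scaleR_left (slice_dy I f x' y'))
        (at y' within Y)" if "x' \<in> A" "y' \<in> Y" for x' y'
      using diff(2)[of x' y'] that Y
      by (auto simp: has_vector_derivative_def blinfun_scaleR_left.rep_eq has_derivative_at_withinI)
  qed (use cont' Y in auto)
  then have "((\<lambda>(x, y). f (slice_pt I x y)) has_derivative
      (\<lambda>(tx, ty). tx *\<^sub>R slice_dx I f x y + ty *\<^sub>R slice_dy I f x y)) (at (x, y))"
    using AB Y by (simp add: at_within_open[OF _ open_Times] blinfun_scaleR_left.rep_eq)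
  moreover have "((\<lambda>z. (Re z, Im z)) has_derivative (\<lambda>h. (Re h, Im h))) (at z)"
    by (auto intro!: derivative_eq_intros)
  ultimately have "((\<lambda>z. (\<lambda>(x, y). f (slice_pt I x y)) (Re z, Im z)) has_derivative
      (\<lambda>h. (\<lambda>(tx, ty). tx *\<^sub>R slice_dx I f x y + ty *\<^sub>R slice_dy I f x y) (Re h, Im h))) (at z)"
    using has_derivative_compose[of "\<lambda>z. (Re z, Im z)" "\<lambda>h. (Re h, Im h)" z UNIV]
    unfolding x_def y_def by blast
  then have "((\<lambda>z. f (slice_embed I z)) has_derivative
      (\<lambda>h. Re h *\<^sub>R slice_dx I f x y + Im h *\<^sub>R slice_dy I f x y)) (at z)"
    by (simp add: slice_embed_def)
  \<comment> \<open>Left multiplication of the Cauchy-Riemann equation by \<open>I\<close> solves it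
    for the other partial derivative.\<close>
  moreover have "slice_dy I f x y = I * slice_dx I f x y"
  proof -
    have "slice_dx I f x y = - (I * slice_dy I f x y)"
      using diff(3)[OF xy] by (simp add: eq_neg_iff_add_eq_0)
    then show ?thesis
      by (simp add: imag_units_square[OF I] flip: mult.assoc)
  qed
  ultimately show "((\<lambda>z. f (slice_embed I z)) has_derivative
      (\<lambda>h. slice_embed I h * slice_dx I f (Re z) (Im z))) (at z)"
    by (simp add: slice_embed_def slice_pt_def x_def y_def distrib_right scaleR_conv_of_real mult.assoc)
qed

lemma slice_regular_imp_slice_holomorphic: "slice_regular f \<Longrightarrow> slice_holomorphic f"
  using slice_regular_imp_has_slice_deriv slice_holomorphic_def by blast

section \<open>Slice derivatives through complex projections\<close>

lemma has_field_derivative_slice_proj: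
  assumes "I \<in> imag_units" "has_slice_deriv I f D" "z \<in> ball 0 1"
  shows "((\<lambda>z. slice_proj I (f (slice_embed I z) * u)) has_field_derivative slice_proj I (D z * u)) (at z)"
proof -
  have "((\<lambda>z. f (slice_embed I z)) has_derivative (\<lambda>h. slice_embed I h * D z)) (at z)"
    using assms by (simp add: has_slice_deriv_def)
  from bounded_linear.has_derivative[OF bounded_linear_slice_proj has_derivative_mult_left[OF this]]
  have "((\<lambda>z. slice_proj I (f (slice_embed I z) * u)) has_derivative
      (\<lambda>h. slice_proj I (slice_embed I h * D z * u))) (at z)" .
  then show ?thesis
    by (simp add: has_field_derivative_def mult.assoc slice_proj_embed_mult[OF assms(1)] mult_commute_abs)
qed

text \<open>Over all right rotations \<open>u\<close> the projections see every component of
  \<open>f\<close>, so their holomorphy can be lifted back to \<open>f\<close>.\<close>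

lemma has_slice_deriv_if_slice_proj_holomorphic:
  assumes I: "I \<in> imag_units"
    and hol: "\<And>u. (\<lambda>z. slice_proj I (f (slice_embed I z) * u)) holomorphic_on ball 0 1"
  shows "\<exists>D. has_slice_deriv I f D"
proof -
  have "\<exists>d. ((\<lambda>z. f (slice_embed I z)) has_derivative (\<lambda>h. slice_embed I h * d)) (at z)"
    if z: "z \<in> ball 0 1" for z
  proof -
    let ?g = "\<lambda>z. f (slice_embed I z)"
    let ?F = "\<lambda>u z. slice_proj I (?g z * u)"
    have F: "(?F u has_derivative (*) (deriv (?F u) z)) (at z)" for u
      using holomorphic_derivI[OF hol open_ball z] by (simp add: has_field_derivative_def)
    have "?g differentiable at z"
      unfolding differentiable_componentwise_within[of ?g]
    proof
      fix b :: quat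
      \<comment> \<open>Each real component of \<open>f\<close> is the real part of a rotated
        projection, which gives real differentiability.\<close>
      have "(\<lambda>z. ?g z \<bullet> b) = (\<lambda>z. Re (?F (quat_cnj b) z))"
        by (simp add: slice_proj_def inner_quat_conv_cnj)
      then show "(\<lambda>z. ?g z \<bullet> b) differentiable at z"
        using has_derivative_Re[OF F[of "quat_cnj b"]] by (auto simp: differentiable_def)
    qed
    then obtain L where L: "(?g has_derivative L) (at z)"
      by (auto simp: differentiable_def)
    have "(?F u has_derivative (\<lambda>h. slice_proj I (L h * u))) (at z)" for u
      by (rule bounded_linear.has_derivative[OF bounded_linear_slice_proj has_derivative_mult_left[OF L]])
    from has_derivative_unique[OF this F]
    have Lu: "slice_proj I (L h * u) = deriv (?F u) z * h" for u h
      by (rule fun_cong)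
    define d where "d = L 1"
    have d: "slice_proj I (d * u) = deriv (?F u) z" for u
      using Lu[of 1 u] by (simp add: d_def)
    \<comment> \<open>Both sides have the same projection after every right rotation.\<close>
    have "L h = slice_embed I h * d" for h
    proof -
      have "slice_proj I ((L h - slice_embed I h * d) * u) = 0" for u
        by (simp add: left_diff_distrib mult.assoc slice_proj_embed_mult[OF I] Lu d
            linear_diff[OF bounded_linear.linear[OF bounded_linear_slice_proj]])
      from quat_eq_0_if_slice_proj[OF I this] show ?thesis by simp
    qed
    then have "L = (\<lambda>h. slice_embed I h * d)"
      by (rule ext)
    with L show ?thesis
      by blast
  qed
  then show ?thesis
    unfolding has_slice_deriv_def by (intro bchoice ballI)
qed

text \<open>The triple picked by \<open>SOME\<close> may differ from \<open>(I, Re z, Im z)\<close>,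
  even in its slice when the point is real. The horizontal line through the point is the same for
  all choices, and so is the derivative along it.\<close>

lemma slice_deriv_embed:
  assumes f: "slice_holomorphic f" and I: "I \<in> imag_units"
    and D: "has_slice_deriv I f D" and z: "z \<in> ball 0 1"
  shows "slice_deriv f (slice_embed I z) = D z"
proof -
  let ?P = "\<lambda>(I', x, y). I' \<in> imag_units \<and> slice_embed I z = slice_pt I' x y"
  obtain I' x y where Ixy: "(SOME p. ?P p) = (I', x, y)"
    by (cases "SOME p. ?P p") auto
  have "?P (I, Re z, Im z)"
    using I by (simp add: slice_embed_def)
  then have "?P (SOME p. ?P p)"
    by (rule someI)
  then have "?P (I', x, y)"
    unfolding Ixy .
  then have I': "I' \<in> imag_units" and eq: "slice_embed I z = slice_pt I' x y"
    by simp_all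
  obtain D' where D': "has_slice_deriv I' f D'"
    using f I' by (auto simp: slice_holomorphic_def)
  have xy: "Complex x y \<in> ball 0 1"
    using z eq norm_slice_embed[OF I, of z] norm_slice_embed[OF I', of "Complex x y"]
    by (simp add: slice_pt_eq_embed)
  have "qRe (slice_embed I z) = qRe (slice_pt I' x y)"
    using eq by simp
  then have x: "x = Re z"
    using I I' by (simp add: slice_embed_def slice_pt_def times_quat_def imag_units_iff)
  \<comment> \<open>Equal real parts leave \<open>y * I' = Im z * I\<close>.\<close>
  with eq have "slice_pt I' t y = slice_pt I t (Im z)" for t
    by (simp add: slice_embed_def slice_pt_def)
  then have "slice_dx I' f x y = slice_dx I f (Re z) (Im z)"
    by (simp add: slice_dx_def x)
  then have DD: "D' (Complex x y) = D z"
    using slice_partials(1)[OF D' xy] slice_partials(1)[OF D, of "Re z" "Im z"] z by simp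
  have "slice_deriv f (slice_embed I z) =
      (1/2) *\<^sub>R (slice_dx I' f x y - I' * slice_dy I' f x y)"
    unfolding slice_deriv_def Ixy by simp
  also have "\<dots> = (1/2) *\<^sub>R (D z + D z)"
    by (simp add: slice_partials[OF D' xy] DD imag_units_square[OF I'] flip: mult.assoc)
  also have "\<dots> = D z"
    by (simp flip: scaleR_2)
  finally show ?thesis .
qed

lemma slice_proj_holomorphic:
  assumes "slice_holomorphic f" "I \<in> imag_units"
  shows "(\<lambda>z. slice_proj I (f (slice_embed I z) * u)) holomorphic_on ball 0 1"
proof -
  obtain D where "has_slice_deriv I f D"
    using assms by (auto simp: slice_holomorphic_def)
  with assms(2) show ?thesis
    unfolding holomorphic_on_open[OF open_ball] using has_field_derivative_slice_proj by blast
qed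

lemma slice_proj_slice_deriv:
  assumes f: "slice_holomorphic f" and I: "I \<in> imag_units" and z: "z \<in> ball 0 1"
  shows "slice_proj I (slice_deriv f (slice_embed I z) * u) =
    deriv (\<lambda>z. slice_proj I (f (slice_embed I z) * u)) z"
proof -
  obtain D where D: "has_slice_deriv I f D"
    using f I by (auto simp: slice_holomorphic_def)
  show ?thesis
    using DERIV_imp_deriv[OF has_field_derivative_slice_proj[OF I D z]] slice_deriv_embed[OF f I D z]
    by simp
qed

text \<open>The projections of the slice derivative are complex derivatives of holomorphic
  functions, hence holomorphic, and the lifting lemma applies.\<close>

lemma slice_holomorphic_slice_deriv:
  assumes f: "slice_holomorphic f"
  shows "slice_holomorphic (slice_deriv f)"
  unfolding slice_holomorphic_def
proof
  fix I assume I: "I \<in> imag_units"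
  show "\<exists>D. has_slice_deriv I (slice_deriv f) D"
  proof (rule has_slice_deriv_if_slice_proj_holomorphic[OF I])
    fix u
    show "(\<lambda>z. slice_proj I (slice_deriv f (slice_embed I z) * u)) holomorphic_on ball 0 1"
      by (rule holomorphic_transform[OF holomorphic_deriv[OF slice_proj_holomorphic[OF f I] open_ball]])
         (simp add: slice_proj_slice_deriv[OF f I])
  qed
qed

lemma slice_proj_higher_slice_deriv:
  assumes f: "slice_holomorphic f" and I: "I \<in> imag_units"
  shows "slice_holomorphic ((slice_deriv ^^ j) f) \<and> (\<forall>z\<in>ball 0 1.
    slice_proj I ((slice_deriv ^^ j) f (slice_embed I z) * u) =
    (deriv ^^ j) (\<lambda>z. slice_proj I (f (slice_embed I z) * u)) z)"
proof (induction j)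
  case 0
  then show ?case using f by simp
next
  case (Suc j)
  let ?h = "(slice_deriv ^^ j) f"
  have h: "slice_holomorphic ?h"
    using Suc by blast
  have "slice_proj I (slice_deriv ?h (slice_embed I z) * u) =
      deriv ((deriv ^^ j) (\<lambda>z. slice_proj I (f (slice_embed I z) * u))) z" if z: "z \<in> ball 0 1" for z
  proof -
    \<comment> \<open>\<open>deriv\<close> depends on values near \<open>z\<close>; the induction
      hypothesis supplies them on the open ball.\<close>
    have "\<forall>\<^sub>F w in nhds z. slice_proj I (?h (slice_embed I w) * u) =
        (deriv ^^ j) (\<lambda>z. slice_proj I (f (slice_embed I z) * u)) w"
      using Suc z by (intro eventually_nhds_in_open[OF open_ball z, THEN eventually_mono]) auto
    then show ?thesis
      unfolding slice_proj_slice_deriv[OF h I z] by (rule deriv_cong_ev) simp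
  qed
  then show ?case
    using slice_holomorphic_slice_deriv[OF h] by simp
qed

section \<open>Bounds for functions into the unit ball\<close>

text \<open>On the circle of radius \<open>r\<close> the hypothesis bounds \<open>K\<close> by
  \<open>1 / r ^ n\<close>. The maximum modulus principle carries this inside, and \<open>r\<close>
  tends to 1.\<close>

lemma norm_le_1_if_power_mult_le_1:
  fixes K :: "complex \<Rightarrow> complex"
  assumes hol: "K holomorphic_on ball 0 1"
    and bound: "\<And>z. z \<in> ball 0 1 \<Longrightarrow> norm (z ^ n * K z) \<le> 1"
    and w: "w \<in> ball 0 1"
  shows "norm (K w) \<le> 1"
proof -
  have "r ^ n * norm (K w) \<le> 1" if r: "norm w < r" "r < 1" for r
  proof -
    have "r > 0" using r norm_ge_zero[of w] by linarith
    have "norm (K w) \<le> 1 / r ^ n"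
    proof (rule maximum_modulus_frontier[of K "ball 0 r"])
      show "K holomorphic_on interior (ball 0 r)"
        using r by (intro holomorphic_on_subset[OF hol]) auto
      show "continuous_on (closure (ball 0 r)) K"
        using r \<open>r > 0\<close> by (intro holomorphic_on_imp_continuous_on holomorphic_on_subset[OF hol]) auto
      show "norm (K z) \<le> 1 / r ^ n" if "z \<in> frontier (ball 0 r)" for z
        using bound[of z] that r \<open>r > 0\<close>
        by (simp add: frontier_ball norm_mult norm_power pos_le_divide_eq mult.commute)
    qed (use r in auto)
    then show ?thesis
      using \<open>r > 0\<close> by (simp add: pos_le_divide_eq mult.commute)
  qed
  then have "\<forall>\<^sub>F r in at_left 1. r ^ n * norm (K w) \<le> 1"
    using w by (auto simp: eventually_at_left_field intro!: exI[of _ "norm w"])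
  moreover have "((\<lambda>r. r ^ n * norm (K w)) \<longlongrightarrow> 1 ^ n * norm (K w)) (at_left 1)"
    by (intro tendsto_intros)
  ultimately show ?thesis
    using tendsto_upperbound[of "\<lambda>r. r ^ n * norm (K w)" "1 ^ n * norm (K w)" "at_left 1" 1]
    by simp
qed

text \<open>The quotient has the index-shifted series, and the value \<open>a n\<close> fills its
  removable singularity at 0.\<close>

lemma power_series_divide_power:
  fixes a :: "nat \<Rightarrow> complex"
  assumes sums: "\<And>z. z \<in> ball 0 1 \<Longrightarrow> (\<lambda>j. a j * z ^ j) sums F z"
    and zero: "\<And>j. j < n \<Longrightarrow> a j = 0"
  obtains H where "H holomorphic_on ball 0 1" "H 0 = a n"
    "\<And>z. z \<in> ball 0 1 \<Longrightarrow> F z = z ^ n * H z"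
proof -
  define H where "H z = (if z = 0 then a n else F z / z ^ n)" for z
  have H_sums: "(\<lambda>j. a (j + n) * z ^ j) sums H z" if z: "z \<in> ball 0 1" for z
  proof (cases "z = 0")
    case True
    then show ?thesis
      using powser_sums_zero[of "\<lambda>j. a (j + n)"] by (simp add: H_def)
  next
    case False
    have "(\<lambda>j. a (j + n) * z ^ (j + n)) sums F z"
      using sums[OF z] zero by (subst sums_iff_shift) simp
    then have "(\<lambda>j. a (j + n) * z ^ (j + n) / z ^ n) sums (F z / z ^ n)"
      by (rule sums_divide)
    then show ?thesis
      using False by (simp add: H_def power_add)
  qed
  show ?thesis
  proof
    show "H holomorphic_on ball 0 1"
      by (rule power_series_holomorphic[of _ _ "\<lambda>j. a (j + n)"]) (use H_sums in simp)
    show "H 0 = a n"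
      by (simp add: H_def)
    show "F z = z ^ n * H z" if z: "z \<in> ball 0 1" for z
    proof (cases "z = 0")
      case True
      have "F 0 = a 0"
        using sums[of 0] powser_sums_zero[of a] by (auto dest: sums_unique2)
      with True zero[of 0] show ?thesis
        by (cases n) (auto simp: H_def)
    qed (simp add: H_def)
  qed
qed

text \<open>The first \<open>n\<close> Taylor coefficients vanish, so \<open>z ^ n\<close> splits
  off and the remaining factor is bounded by 1.\<close>

lemma Schwarz_higher_order:
  fixes F :: "complex \<Rightarrow> complex"
  assumes hol: "F holomorphic_on ball 0 1"
    and bound: "\<And>z. z \<in> ball 0 1 \<Longrightarrow> norm (F z) \<le> 1"
    and zero: "\<And>j. j < n \<Longrightarrow> (deriv ^^ j) F 0 = 0"
    and z: "z \<in> ball 0 1"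
  shows "norm (F z) \<le> norm z ^ n"
proof -
  obtain H where H: "H holomorphic_on ball 0 1" "\<And>z. z \<in> ball 0 1 \<Longrightarrow> F z = z ^ n * H z"
    by (rule power_series_divide_power[of "\<lambda>j. (deriv ^^ j) F 0 / fact j" F n])
       (use holomorphic_power_series[OF hol] zero in auto)
  have "norm (H z) \<le> 1"
    by (rule norm_le_1_if_power_mult_le_1[OF H(1) _ z, of n]) (use bound H(2) in auto)
  then show ?thesis
    using H(2)[OF z] by (simp add: norm_mult norm_power mult_left_le)
qed

text \<open>Averaging over the rotations by \<open>k\<close>-th roots of unity removes the coefficients
  of index \<open>1, \<dots>, k - 1\<close>; composing with a disc automorphism that maps the constant
  coefficient to 0 then leaves a function with a zero of order \<open>k\<close>.\<close>

lemma coeff_bound_of_unit_disc_map: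
  fixes a :: "nat \<Rightarrow> complex"
  assumes sums: "\<And>z. z \<in> ball 0 1 \<Longrightarrow> (\<lambda>j. a j * z ^ j) sums F z"
    and bound: "\<And>z. z \<in> ball 0 1 \<Longrightarrow> norm (F z) < 1"
    and k: "1 \<le> k"
  shows "norm (a k) \<le> 1 - (norm (a 0))\<^sup>2"
proof -
  \<comment> \<open>For \<open>i < k\<close> these are the \<open>k\<close>-th roots of unity;
    \<open>G\<close> is the average over the rotations and \<open>b\<close> its coefficient
    sequence.\<close>
  define \<zeta> where "\<zeta> j = exp (2 * of_real pi * \<i> * of_nat j / of_nat k)" for j :: nat
  define G where "G z = (\<Sum>i<k. F (\<zeta> i * z)) / of_nat k" for z
  define b where "b n = (\<Sum>i<k. \<zeta> i ^ n) / of_nat k * a n" for n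
  have norm_\<zeta>: "norm (\<zeta> j) = 1" for j
    by (simp add: \<zeta>_def)
  \<comment> \<open>Swapping \<open>i\<close> and \<open>n\<close> makes the sum in
    \<open>b n\<close> a geometric series in \<open>\<zeta> n\<close>.\<close>
  have \<zeta>_power: "\<zeta> i ^ n = \<zeta> n ^ i" for i n
    by (simp add: \<zeta>_def mult_ac flip: exp_of_nat_mult)
  have \<zeta>_k: "\<zeta> n ^ k = 1" for n
    unfolding \<zeta>_def by (rule complex_root_unity) (use k in simp)
  have \<zeta>_eq_1: "\<zeta> n = 1 \<longleftrightarrow> k dvd n" for n
    unfolding \<zeta>_def by (rule complex_root_unity_eq_1) (use k in simp)
  have ball_\<zeta>: "\<zeta> i * z \<in> ball 0 1" if "z \<in> ball 0 1" for i z
    using that by (simp add: norm_mult norm_\<zeta>)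
  have b_0: "b 0 = a 0"
    using k by (simp add: b_def)
  have b_k: "b k = a k"
    using k by (simp add: b_def \<zeta>_k)
  have b_eq_0: "b n = 0" if "0 < n" "n < k" for n
  proof -
    have "\<zeta> n \<noteq> 1"
      using that \<zeta>_eq_1 by (auto dest: dvd_imp_le)
    then show ?thesis
      by (simp add: b_def \<zeta>_power[of _ n] geometric_sum \<zeta>_k)
  qed
  have G_sums: "(\<lambda>n. b n * z ^ n) sums G z" if z: "z \<in> ball 0 1" for z
  proof -
    have "(\<lambda>n. (\<Sum>i<k. a n * (\<zeta> i * z) ^ n) / of_nat k) sums G z"
      unfolding G_def by (intro sums_divide sums_sum sums ball_\<zeta> z)
    moreover have "(\<Sum>i<k. a n * (\<zeta> i * z) ^ n) / of_nat k = b n * z ^ n" for n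
      by (simp add: b_def power_mult_distrib sum_distrib_left sum_distrib_right mult_ac)
    ultimately show ?thesis by simp
  qed
  have G_bound: "norm (G z) < 1" if z: "z \<in> ball 0 1" for z
  proof -
    have "norm (\<Sum>i<k. F (\<zeta> i * z)) \<le> (\<Sum>i<k. norm (F (\<zeta> i * z)))"
      by (rule norm_sum)
    also have "\<dots> < (\<Sum>i<k. 1)"
      using k by (intro sum_strict_mono bound ball_\<zeta> z) (auto simp: lessThan_empty_iff)
    finally show ?thesis
      using k by (simp add: G_def norm_divide)
  qed
  have G_0: "G 0 = a 0"
    using G_sums[of 0] powser_sums_zero[of b] b_0 by (auto dest: sums_unique2)
  have a0: "norm (a 0) < 1"
    using G_bound[of 0] by (simp add: G_0)
  have "(\<lambda>n. (if n = 0 then 0 else b n) * z ^ n) sums (G z - a 0)" if "z \<in> ball 0 1" for z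
  proof -
    have "(\<lambda>n. b n * z ^ n - (if n = 0 then a 0 else 0)) sums (G z - a 0)"
      by (intro sums_diff G_sums that sums_single)
    then show ?thesis
      by (rule sums_cong[THEN iffD1, rotated]) (simp add: b_0)
  qed
  then obtain H where H: "H holomorphic_on ball 0 1" "H 0 = a k"
    "\<And>z. z \<in> ball 0 1 \<Longrightarrow> G z - a 0 = z ^ k * H z"
    by (rule power_series_divide_power[of "\<lambda>n. if n = 0 then 0 else b n" "\<lambda>z. G z - a 0" k])
       (use b_eq_0 b_k k in \<open>auto split: if_splits\<close>)
  \<comment> \<open>Up to the factor \<open>z ^ k\<close> this is \<open>G\<close> followed by the
    disc automorphism that sends \<open>a 0\<close> to 0.\<close>
  define K where "K z = H z / (1 - cnj (a 0) * G z)" for z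
  have "norm (cnj (a 0) * G z) < 1" if "z \<in> ball 0 1" for z
    using a0 G_bound[OF that] mult_strict_mono'[of "norm (a 0)" 1 "norm (G z)" 1]
    by (simp add: norm_mult)
  then have nz: "1 - cnj (a 0) * G z \<noteq> 0" if "z \<in> ball 0 1" for z
    using that by (metis norm_one less_irrefl right_minus_eq)
  have "G holomorphic_on ball 0 1"
    by (rule power_series_holomorphic[of _ _ b]) (use G_sums in simp)
  then have "K holomorphic_on ball 0 1"
    unfolding K_def using nz H(1) by (intro holomorphic_intros) auto
  moreover have "norm (z ^ k * K z) \<le> 1" if z: "z \<in> ball 0 1" for z
  proof -
    have "z ^ k * K z = Moebius_function 0 (a 0) (G z)"
      by (simp add: K_def Moebius_function_simple H(3)[OF z])
    then show ?thesis
      using Moebius_function_norm_lt_1[OF a0 G_bound[OF z], of 0] by simp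
  qed
  ultimately have "norm (K 0) \<le> 1"
    by (rule norm_le_1_if_power_mult_le_1) auto
  moreover have "cnj (a 0) * a 0 = of_real ((norm (a 0))\<^sup>2)"
    by (metis complex_norm_square mult.commute)
  \<comment> \<open>As \<open>G 0 = a 0\<close>, the denominator at 0 is the claimed bound
    itself.\<close>
  then have "K 0 = a k / of_real (1 - (norm (a 0))\<^sup>2)"
    by (simp add: K_def H(2) G_0)
  moreover have "1 - (norm (a 0))\<^sup>2 > 0"
    using a0 by (simp add: power_less_one_iff)
  ultimately show ?thesis
    by (simp add: norm_divide del: of_real_diff)
qed

section \<open>Transfer of the bounds to the quaternionic ball\<close>

lemma sums_at_0_eq:
  fixes p :: "nat \<Rightarrow> quat"
  shows "(\<lambda>k. 0 ^ k * p k) sums s \<longleftrightarrow> s = p 0"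
proof -
  have "(\<lambda>k. 0 ^ k * p k) = (\<lambda>k. if k = 0 then p k else 0)"
    by (auto simp: fun_eq_iff)
  then have "(\<lambda>k. 0 ^ k * p k) sums p 0"
    using sums_single[of 0 p] by simp
  then show ?thesis
    by (auto dest: sums_unique2)
qed

lemma SB_norm_coeff_0_less:
  assumes "f \<in> SB" "has_power_series f p"
  shows "norm (p 0) < 1"
proof -
  have "f 0 = p 0"
    using assms(2) sums_at_0_eq[of p "f 0"] by (auto simp: has_power_series_def dest: bspec[of _ _ 0])
  then show ?thesis
    using assms(1) by (auto simp: SB_def dest: bspec[of _ _ 0])
qed

text \<open>After a right rotation \<open>p 0\<close> is real, so on the slice through the rotated \<open>p k\<close>
  both coefficients are complex and the projection to that slice loses neither.\<close>

lemma SB_norm_coeff_le: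
  assumes f: "f \<in> SB" and p: "has_power_series f p" and k: "1 \<le> k"
  shows "norm (p k) \<le> 1 - (norm (p 0))\<^sup>2"
proof -
  obtain u where u: "norm u = 1" "p 0 * u = of_real (norm (p 0))"
    by (rule ex_unit_rotation_to_norm)
  obtain I w where I: "I \<in> imag_units" and w: "p k * u = slice_embed I w"
    by (rule ex_slice_embed)
  let ?a = "\<lambda>j. slice_proj I (p j * u)"
  have sums: "(\<lambda>j. ?a j * z ^ j) sums slice_proj I (f (slice_embed I z) * u)"
    if z: "z \<in> ball 0 1" for z
  proof -
    have "(\<lambda>j. slice_embed I z ^ j * p j) sums f (slice_embed I z)"
      using p z by (simp add: has_power_series_def norm_slice_embed[OF I])
    from bounded_linear.sums[OF bounded_linear_slice_proj sums_mult2[OF this]]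
    have "(\<lambda>j. slice_proj I (slice_embed I z ^ j * p j * u))
      sums slice_proj I (f (slice_embed I z) * u)" .
    then show ?thesis
      by (simp add: mult.assoc slice_proj_embed_mult[OF I] mult.commute flip: slice_embed_power[OF I])
  qed
  have "norm (?a k) \<le> 1 - (norm (?a 0))\<^sup>2"
  proof (rule coeff_bound_of_unit_disc_map[OF sums _ k])
    show "norm (slice_proj I (f (slice_embed I z) * u)) < 1" if "z \<in> ball 0 1" for z
    proof -
      have "norm (f (slice_embed I z)) < 1"
        using f that by (simp add: SB_def norm_slice_embed[OF I])
      then show ?thesis
        using norm_slice_proj_le[OF I, of "f (slice_embed I z) * u"] u(1) by (simp add: norm_mult)
    qed
  qed
  moreover have "norm (?a k) = norm (p k)"
    using norm_mult[of "p k" u] u(1) by (simp add: w slice_proj_embed[OF I] norm_slice_embed[OF I])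
  moreover have "?a 0 = of_real (norm (p 0))"
    unfolding u(2) using slice_proj_embed[OF I, of "of_real (norm (p 0))"] by simp
  ultimately show ?thesis by simp
qed

text \<open>On the slice through \<open>q\<close>, rotated so that \<open>w q\<close> becomes real,
  the projection keeps the norm of \<open>w q\<close>. Its derivatives at 0 are projections of slice
  derivatives, so the complex Schwarz lemma applies.\<close>

lemma SB_ord_norm_le:
  assumes w: "w \<in> SB_ord n" and q: "norm q < 1"
  shows "norm (w q) \<le> norm q ^ n"
proof -
  obtain I z where I: "I \<in> imag_units" and z: "q = slice_embed I z"
    by (rule ex_slice_embed)
  obtain u where u: "norm u = 1" "w q * u = of_real (norm (w q))"
    by (rule ex_unit_rotation_to_norm)
  let ?F = "\<lambda>z. slice_proj I (w (slice_embed I z) * u)"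
  have reg: "slice_holomorphic w" and bound: "\<And>q. norm q < 1 \<Longrightarrow> norm (w q) < 1"
    and zero: "\<And>j. j < n \<Longrightarrow> (slice_deriv ^^ j) w 0 = 0"
    using w by (auto simp: SB_ord_def SB_def slice_regular_imp_slice_holomorphic)
  have "norm (?F z) \<le> norm z ^ n"
  proof (rule Schwarz_higher_order)
    show "?F holomorphic_on ball 0 1"
      by (rule slice_proj_holomorphic[OF reg I])
    show "norm (?F z) \<le> 1" if "z \<in> ball 0 1" for z
      using norm_slice_proj_le[OF I, of "w (slice_embed I z) * u"] bound[of "slice_embed I z"] that u(1)
      by (simp add: norm_mult norm_slice_embed[OF I])
    show "(deriv ^^ j) ?F 0 = 0" if "j < n" for j
      using slice_proj_higher_slice_deriv[OF reg I, of j u] zero[OF that]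
        linear_0[OF bounded_linear.linear[OF bounded_linear_slice_proj]] by (auto dest: bspec[of _ _ 0])
    show "z \<in> ball 0 1"
      using q by (simp add: z norm_slice_embed[OF I])
  qed
  moreover have "?F z = of_real (norm (w q))"
    using u(2) slice_proj_embed[OF I, of "of_real (norm (w q))"] by (simp flip: z)
  moreover have "norm z = norm q"
    by (simp add: z norm_slice_embed[OF I])
  ultimately show ?thesis by simp
qed

section \<open>Extremal functions\<close>

text \<open>A function that acts on every slice as the same holomorphic \<open>F\<close> has the
  embedded \<open>deriv F\<close> as its slice derivative.\<close>

lemma slice_regular_if_intrinsic:
  assumes F: "F holomorphic_on ball 0 1"
    and fF: "\<And>I z. I \<in> imag_units \<Longrightarrow> f (slice_embed I z) = slice_embed I (F z)"
  shows "slice_regular f"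
proof (rule slice_regularI)
  fix I assume I: "I \<in> imag_units"
  have "has_slice_deriv I f (\<lambda>z. slice_embed I (deriv F z))"
    unfolding has_slice_deriv_def
  proof
    fix z :: complex assume "z \<in> ball 0 1"
    then have "(F has_derivative (*) (deriv F z)) (at z)"
      using holomorphic_derivI[OF F open_ball] by (simp add: has_field_derivative_def)
    from bounded_linear.has_derivative[OF bounded_linear_slice_embed[of I] this]
    show "((\<lambda>z. f (slice_embed I z)) has_derivative
        (\<lambda>h. slice_embed I h * slice_embed I (deriv F z))) (at z)"
      by (simp add: fF[OF I] mult.commute[of "deriv F z"] slice_embed_mult[OF I])
  qed
  moreover have "continuous_on (ball 0 1) (\<lambda>z. slice_embed I (deriv F z))"
    using F by (intro bounded_linear.continuous_on[OF bounded_linear_slice_embed]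
        holomorphic_on_imp_continuous_on holomorphic_deriv) auto
  ultimately show "\<exists>D. has_slice_deriv I f D \<and> continuous_on (ball 0 1) D"
    by blast
qed

lemma monomial_in_SB_ord:
  assumes \<rho>: "0 < \<rho>" "\<rho> < 1"
  shows "(\<lambda>q. of_real \<rho> * q ^ n) \<in> SB_ord n"
proof -
  let ?w = "\<lambda>q::quat. of_real \<rho> * q ^ n"
  have embed: "?w (slice_embed I z) = slice_embed I (of_real \<rho> * z ^ n)" if "I \<in> imag_units" for I z
    by (simp add: slice_embed_mult[OF that] slice_embed_power[OF that])
  have reg: "slice_regular ?w"
    by (rule slice_regular_if_intrinsic[of "\<lambda>z. of_real \<rho> * z ^ n"])
       (auto intro!: holomorphic_intros simp: embed)
  have "norm (?w q) < 1" if "norm q \<le> 1" for q :: quat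
  proof -
    have "\<rho> * norm q ^ n \<le> \<rho>"
      using \<rho> that by (simp add: mult_left_le power_le_one)
    from le_less_trans[OF this \<rho>(2)] show ?thesis
      using \<rho> by (simp add: norm_mult norm_power)
  qed
  then have SB: "?w \<in> SB"
    using reg by (auto simp: SB_def intro!: continuous_intros)
  \<comment> \<open>The power of 0 vanishes for \<open>j < n\<close>; at \<open>j = n\<close> it is
    1 and the Pochhammer factor is \<open>fact n\<close>.\<close>
  have deriv: "slice_proj I ((slice_deriv ^^ j) ?w 0 * u) =
      of_real \<rho> * slice_proj I u * (pochhammer (of_nat (Suc n - j)) j * 0 ^ (n - j))"
    if I: "I \<in> imag_units" for I u j
  proof -
    have "slice_proj I ((slice_deriv ^^ j) ?w 0 * u) =
        (deriv ^^ j) (\<lambda>z. slice_proj I (?w (slice_embed I z) * u)) 0"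
      using slice_proj_higher_slice_deriv[OF slice_regular_imp_slice_holomorphic[OF reg] I, of j u]
      by (auto dest: bspec[of _ _ 0])
    also have "\<dots> = (deriv ^^ j) (\<lambda>z. (of_real \<rho> * slice_proj I u) * z ^ n) 0"
      by (simp add: embed[OF I] slice_proj_embed_mult[OF I] mult_ac)
    also have "\<dots> = (of_real \<rho> * slice_proj I u) * (deriv ^^ j) (\<lambda>z. z ^ n) 0"
      by (rule higher_deriv_cmult[of _ UNIV]) (auto intro!: holomorphic_intros)
    finally show ?thesis
      using higher_deriv_power[of j "0::complex" n 0] by simp
  qed
  have I: "Quat 0 1 0 0 \<in> imag_units"
    by (simp add: imag_units_iff)
  have "(slice_deriv ^^ j) ?w 0 = 0" if "j < n" for j
    using that by (intro quat_eq_0_if_slice_proj[OF I]) (simp add: deriv[OF I])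
  moreover have "(slice_deriv ^^ n) ?w 0 \<noteq> 0"
  proof
    assume "(slice_deriv ^^ n) ?w 0 = 0"
    then have "of_real \<rho> * slice_proj (Quat 0 1 0 0) 1 * fact n = 0"
      using deriv[OF I, of n 1] linear_0[OF bounded_linear.linear[OF bounded_linear_slice_proj]]
      by (simp add: pochhammer_fact)
    moreover have "slice_proj (Quat 0 1 0 0) 1 = 1"
      using slice_proj_embed[OF I, of 1] by simp
    ultimately show False
      using \<rho> by simp
  qed
  ultimately show ?thesis
    using SB by (simp add: SB_ord_def)
qed

lemma one_minus_of_real_mult_nonzero:
  fixes z :: "'a :: real_normed_div_algebra"
  assumes "0 < a" "a < 1" "norm z \<le> 1"
  shows "1 - of_real a * z \<noteq> 0"
proof
  assume "1 - of_real a * z = 0"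
  then have "norm (of_real a * z) = 1"
    by simp
  then show False
    using assms mult_left_le[of "norm z" a] by (simp add: norm_mult)
qed

text \<open>With real parameters \<open>f\<close> acts on each slice as a complex Moebius map times
  \<open>\<rho>\<close>. Writing it as \<open>\<rho> * a\<close> minus
  \<open>\<rho> * (1 - a\<^sup>2) * z / (1 - a * z)\<close> and expanding the geometric series gives
  \<open>p\<close>.\<close>

lemma quat_moebius_in_SB:
  assumes \<rho>: "0 < \<rho>" "\<rho> < 1" and a: "0 < a" "a < 1"
  defines "f \<equiv> \<lambda>q::quat. of_real \<rho> * (of_real a - q) * inverse (1 - of_real a * q)"
    and "p \<equiv> \<lambda>k. of_real (case k of 0 \<Rightarrow> \<rho> * a | Suc j \<Rightarrow> - (\<rho> * (1 - a\<^sup>2) * a ^ j))"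
  shows "f \<in> SB" and "has_power_series f p"
proof -
  define F where "F z = of_real \<rho> * (of_real a - z) * inverse (1 - of_real a * z)" for z :: complex
  have embed: "f (slice_embed I z) = slice_embed I (F z)" if I: "I \<in> imag_units" for I z
    by (simp add: f_def F_def slice_embed_mult[OF I] slice_embed_inverse[OF I]
        linear_diff[OF bounded_linear.linear[OF bounded_linear_slice_embed]])
  note nz = one_minus_of_real_mult_nonzero[OF a]
  have "slice_regular f"
    by (rule slice_regular_if_intrinsic[OF _ embed])
       (auto simp: F_def[abs_def] intro!: holomorphic_intros nz)
  moreover have "continuous_on (cball 0 1) f"
    unfolding f_def by (intro continuous_intros ballI nz) simp
  moreover have "norm (f q) < 1" if q: "norm q \<le> 1" for q
  proof -
    \<comment> \<open>The identity that shows why Moebius maps preserve the ball.\<close>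
    have "(norm (1 - of_real a * q))\<^sup>2 - (norm (of_real a - q))\<^sup>2 = (1 - a\<^sup>2) * (1 - (norm q)\<^sup>2)"
      unfolding power2_norm_eq_inner inner_quat_def
      by (simp add: times_quat_def power2_eq_square algebra_simps)
    moreover have "0 \<le> (1 - a\<^sup>2) * (1 - (norm q)\<^sup>2)"
      using a q by (intro mult_nonneg_nonneg) (auto simp: power_le_one)
    ultimately have "(norm (of_real a - q))\<^sup>2 \<le> (norm (1 - of_real a * q))\<^sup>2"
      by linarith
    then have "norm (of_real a - q) \<le> norm (1 - of_real a * q)"
      by (rule power2_le_imp_le) simp
    moreover have "norm (1 - of_real a * q) > 0"
      using nz[OF q] by simp
    ultimately have "\<rho> * (norm (of_real a - q) / norm (1 - of_real a * q)) \<le> \<rho>"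
      using \<rho> by (intro mult_left_le) auto
    from le_less_trans[OF this \<rho>(2)] show ?thesis
      using \<rho> by (simp add: f_def norm_mult norm_inverse divide_inverse mult.assoc)
  qed
  ultimately show "f \<in> SB"
    by (simp add: SB_def)
  show "has_power_series f p"
    unfolding has_power_series_def
  proof
    fix q :: quat assume q: "q \<in> ball 0 1"
    obtain I z where I: "I \<in> imag_units" and z: "q = slice_embed I z"
      by (rule ex_slice_embed)
    have nz': "norm z < 1"
      using q by (simp add: z norm_slice_embed[OF I])
    let ?c = "\<lambda>k. complex_of_real (case k of 0 \<Rightarrow> \<rho> * a | Suc j \<Rightarrow> - (\<rho> * (1 - a\<^sup>2) * a ^ j))"
    have "norm (of_real a * z) < 1"
      using nz' a mult_strict_mono'[of a 1 "norm z" 1] by (simp add: norm_mult)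
    from sums_mult[OF geometric_sums[OF this], of "- (of_real (\<rho> * (1 - a\<^sup>2)) * z)"]
    have "(\<lambda>j. z ^ Suc j * ?c (Suc j)) sums (- (of_real (\<rho> * (1 - a\<^sup>2)) * z) * (1 / (1 - of_real a * z)))"
      by (simp add: power_mult_distrib mult_ac)
    then have "(\<lambda>j. z ^ j * ?c j) sums
        (- (of_real (\<rho> * (1 - a\<^sup>2)) * z) * (1 / (1 - of_real a * z)) + z ^ 0 * ?c 0)"
      by (rule sums_Suc_iff[THEN iffD1])
    also have "- (of_real (\<rho> * (1 - a\<^sup>2)) * z) * (1 / (1 - of_real a * z)) + z ^ 0 * ?c 0 = F z"
      using nz[of z] nz' by (simp add: F_def field_simps power2_eq_square)
    finally have "(\<lambda>j. slice_embed I (z ^ j * ?c j)) sums slice_embed I (F z)"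
      by (rule bounded_linear.sums[OF bounded_linear_slice_embed])
    then show "(\<lambda>k. q ^ k * p k) sums f q"
      by (simp only: slice_embed_mult[OF I] slice_embed_power[OF I] slice_embed_of_real z
          embed[OF I] p_def)
  qed
qed

section \<open>The Bohr inequality\<close>

text \<open>Weighted arithmetic-geometric mean of \<open>a\<close> and 1 with weights
  \<open>m\<close> and \<open>1 - m\<close>.\<close>

lemma powr_le_linear:
  fixes a m :: real
  assumes "0 \<le> a" "0 < m" "m \<le> 1"
  shows "a powr m \<le> 1 - m * (1 - a)"
proof (cases "a = 0")
  case False
  then show ?thesis
    using Youngs_inequality_0[of m "1 - m" a 1] assms by (simp add: algebra_simps)
qed (use assms in simp)

text \<open>The leading 8 is 2 times 4, and 4 is the maximum of \<open>x * (1 + x)\<^sup>2\<close>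
  on \<open>[0, 1]\<close>, the \<open>k = 1\<close> case of the formula for \<open>c_const\<close>.
  So the first term fits the general pattern.\<close>

lemma L_sum_eq:
  assumes "1 \<le> N"
  shows "L_sum m N d = (\<Sum>k=1..N. 2 * (2 * real k - 1) * (if k = 1 then 4 else c_const k)
    * d k * M_const m ^ (2 * k))"
proof -
  have "(\<Sum>k=2..N. 2 * (2 * real k - 1) * c_const k * d k * M_const m ^ (2 * k)) =
      (\<Sum>k=2..N. 2 * (2 * real k - 1) * (if k = 1 then 4 else c_const k) * d k * M_const m ^ (2 * k))"
    by (rule sum.cong) auto
  then show ?thesis
    using assms by (simp add: L_sum_def sum.atLeast_Suc_atMost numeral_2_eq_2)
qed

text \<open>The hypothesis on \<^const>\<open>L_sum\<close> says that the left-hand side minus \<open>m / (1 + x)\<close>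
  is nondecreasing on \<open>[0, 1]\<close>; the two sides agree at \<open>x = 1\<close>.\<close>

lemma weighted_sum_le:
  assumes x: "0 \<le> x" "x \<le> 1" and N: "1 \<le> N"
    and d: "\<forall>i\<in>{1..N}. 0 \<le> d i" and L: "L_sum m N d \<le> m"
  shows "(\<Sum>k=1..N. d k * M_const m ^ (2 * k) * (1 - x\<^sup>2) ^ (2 * k - 1)) \<le> m / (1 + x) - m / 2"
proof -
  define \<phi> where "\<phi> x = (\<Sum>k=1..N. d k * M_const m ^ (2 * k) * (1 - x\<^sup>2) ^ (2 * k - 1)) - m / (1 + x)" for x
  have "\<phi> x \<le> \<phi> 1"
  proof (rule DERIV_nonneg_imp_nondecreasing[OF x(2)])
    fix y assume y: "x \<le> y" "y \<le> 1"
    then have y0: "0 \<le> y" using x by simp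
    \<comment> \<open>The weighted sum has derivative \<open>- S\<close> at
      \<open>y\<close>.\<close>
    define S where "S = (\<Sum>k=1..N. d k * M_const m ^ (2 * k) *
      (real (2 * k - 1) * (2 * y) * (1 - y\<^sup>2) ^ (2 * k - 2)))"
    have "(\<phi> has_real_derivative - S + m / (1 + y)\<^sup>2) (at y)"
      unfolding \<phi>_def[abs_def] S_def using y0
      by (auto intro!: derivative_eq_intros sum.cong
          simp: sum_negf[symmetric] power2_eq_square numeral_2_eq_2)
    moreover have "(1 + y)\<^sup>2 * S \<le> m"
    proof -
      have "(1 + y)\<^sup>2 * S \<le> L_sum m N d"
        unfolding S_def L_sum_eq[OF N] sum_distrib_left
      proof (rule sum_mono)
        fix k assume k: "k \<in> {1..N}"
        have "y * (1 + y)\<^sup>2 * (1 - y\<^sup>2) ^ (2 * k - 2) \<le> (if k = 1 then 4 else c_const k)"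
        proof (cases "k = 1")
          case True
          have "y * (1 + y)\<^sup>2 \<le> 1 * 2\<^sup>2"
            using y y0 by (intro mult_mono power_mono) auto
          then show ?thesis using True by simp
        next
          case False
          then show ?thesis using c_const_is_max(2)[of y k] y y0 by simp
        qed
        then have "(2 * (2 * real k - 1) * d k * M_const m ^ (2 * k)) * (y * (1 + y)\<^sup>2 * (1 - y\<^sup>2) ^ (2 * k - 2))
            \<le> (2 * (2 * real k - 1) * d k * M_const m ^ (2 * k)) * (if k = 1 then 4 else c_const k)"
          using d k by (intro mult_left_mono mult_nonneg_nonneg) (auto simp: power_mult)
        then show "(1 + y)\<^sup>2 * (d k * M_const m ^ (2 * k) *
            (real (2 * k - 1) * (2 * y) * (1 - y\<^sup>2) ^ (2 * k - 2)))
            \<le> 2 * (2 * real k - 1) * (if k = 1 then 4 else c_const k) * d k * M_const m ^ (2 * k)"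
          using k by (simp add: of_nat_diff mult_ac)
      qed
      with L show ?thesis by simp
    qed
    then have "S \<le> m / (1 + y)\<^sup>2"
      using y0 by (simp add: pos_le_divide_eq mult.commute)
    ultimately show "\<exists>l. (\<phi> has_real_derivative l) (at y) \<and> 0 \<le> l"
      by (intro exI[of _ "- S + m / (1 + y)\<^sup>2"]) simp
  qed
  \<comment> \<open>All exponents \<open>2 * k - 1\<close> are positive, so every summand vanishes
    at 1.\<close>
  moreover have "\<phi> 1 = - (m / 2)"
    by (auto simp: \<phi>_def power_0_left intro!: sum.neutral)
  ultimately show ?thesis
    by (simp add: \<phi>_def)
qed

text \<open>Taking one factor \<open>1 - a\<^sup>2\<close> out of the sum leaves the sum of
  \<open>weighted_sum_le\<close>. Since \<open>(1 - a\<^sup>2) / (1 + a) = 1 - a\<close>, the terms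
  with \<open>m / 2\<close> cancel and the linear bound on \<open>a powr m\<close> finishes.\<close>

lemma bohr_real_inequality:
  assumes m: "0 < m" "m \<le> 1" and N: "1 \<le> N"
    and d: "\<forall>i\<in>{1..N}. 0 \<le> d i" and L: "L_sum m N d \<le> m"
    and a: "0 \<le> a" "a \<le> 1"
  shows "a powr m + (1 - a\<^sup>2) * (m / 2) + (\<Sum>k=1..N. d k * (((1 - a\<^sup>2) * M_const m)\<^sup>2) ^ k) \<le> 1"
proof -
  let ?T = "\<Sum>k=1..N. d k * M_const m ^ (2 * k) * (1 - a\<^sup>2) ^ (2 * k - 1)"
  have "(((1 - a\<^sup>2) * M_const m)\<^sup>2) ^ k = (1 - a\<^sup>2) * (M_const m ^ (2 * k) * (1 - a\<^sup>2) ^ (2 * k - 1))"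
    if "k \<in> {1..N}" for k
  proof -
    have "(1 - a\<^sup>2) * (1 - a\<^sup>2) ^ (2 * k - 1) = (1 - a\<^sup>2) ^ (2 * k)"
      using that by (simp flip: power_Suc)
    then show ?thesis
      by (simp add: power_mult_distrib mult.left_commute mult.commute flip: power_mult)
  qed
  then have "(\<Sum>k=1..N. d k * (((1 - a\<^sup>2) * M_const m)\<^sup>2) ^ k) = (1 - a\<^sup>2) * ?T"
    by (simp add: sum_distrib_left mult_ac)
  also have "\<dots> \<le> (1 - a\<^sup>2) * (m / (1 + a) - m / 2)"
    using a weighted_sum_le[OF a N d L] by (intro mult_left_mono) (auto simp: power_le_one)
  also have "\<dots> = m * (1 - a) - (1 - a\<^sup>2) * (m / 2)"
    using a by (simp add: field_simps power2_eq_square)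
  finally show ?thesis
    using powr_le_linear[OF a(1) m] by simp
qed

lemma poly_Q_poly: "poly (Q_poly N d) x = (\<Sum>i=1..N. d i * x ^ i)"
  by (simp add: Q_poly_def poly_sum poly_monom)

text \<open>With \<open>r = norm q\<close>, the differentiated geometric series sums
  \<open>k * r ^ (2 * k)\<close> over positive \<open>k\<close> to the square of
  \<open>r / (1 - r\<^sup>2)\<close>.\<close>

lemma S_star_bounds:
  assumes q: "norm q < 1" and p: "\<And>k. norm (p (Suc k)) \<le> B"
  shows "summable (\<lambda>k. real (Suc k) * (norm (q ^ Suc k * p (Suc k)))\<^sup>2)"
    and "0 \<le> S_star p q"
    and "S_star p q \<le> (B * (norm q / (1 - (norm q)\<^sup>2)))\<^sup>2"
proof -
  let ?s = "\<lambda>k. real (Suc k) * (norm (q ^ Suc k * p (Suc k)))\<^sup>2"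
  have "norm ((norm q)\<^sup>2) < 1"
    using q by (simp add: power_less_one_iff)
  from sums_mult[OF geometric_deriv_sums[OF this], of "(B * norm q)\<^sup>2"]
  have sums: "(\<lambda>k. (B * norm q)\<^sup>2 * (real (Suc k) * ((norm q)\<^sup>2) ^ k)) sums
      (B * (norm q / (1 - (norm q)\<^sup>2)))\<^sup>2"
    by (simp add: power_divide power_mult_distrib)
  have le: "?s k \<le> (B * norm q)\<^sup>2 * (real (Suc k) * ((norm q)\<^sup>2) ^ k)" for k
  proof -
    have "(norm (q ^ Suc k * p (Suc k)))\<^sup>2 \<le> (norm q ^ Suc k * B)\<^sup>2"
      unfolding norm_mult norm_power by (intro power_mono mult_left_mono p) auto
    also have "\<dots> = (B * norm q)\<^sup>2 * ((norm q)\<^sup>2) ^ k"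
      by (simp add: power_mult_distrib mult_ac flip: power_mult)
    finally show ?thesis
      using mult_left_mono[of _ _ "real (Suc k)"] by (simp add: mult_ac)
  qed
  show summable: "summable ?s"
    by (rule summable_comparison_test'[OF sums_summable[OF sums], of 0]) (use le in auto)
  show "0 \<le> S_star p q"
    unfolding S_star_def by (rule suminf_nonneg[OF summable]) simp
  show "S_star p q \<le> (B * (norm q / (1 - (norm q)\<^sup>2)))\<^sup>2"
    unfolding S_star_def by (rule sums_le[OF le summable_sums[OF summable] sums])
qed

lemma bohr_inequality:
  assumes m: "0 < m" "m \<le> 1" and N: "1 \<le> N"
    and d: "\<forall>i\<in>{1..N}. 0 \<le> d i" and L: "L_sum m N d \<le> m"
    and f: "f \<in> SB" "has_power_series f p" and \<omega>: "\<forall>k\<ge>1. \<omega> k \<in> SB_ord k"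
    and q: "norm q \<le> m / (2 + m)"
  shows "bohr_summable p \<omega> q" and "bohr_sum m N d p \<omega> q \<le> 1"
proof -
  define a where "a = norm (p 0)"
  define r where "r = norm q"
  have a: "0 \<le> a" "a \<le> 1"
    using SB_norm_coeff_0_less[OF f] by (auto simp: a_def)
  have a2: "0 \<le> 1 - a\<^sup>2"
    using a by (simp add: power_le_one)
  have r: "0 \<le> r" "r \<le> m / (2 + m)" "m / (2 + m) < 1"
    using q m by (auto simp: r_def)
  then have r1: "r < 1" by linarith
  have p: "norm (p (Suc k)) \<le> 1 - a\<^sup>2" for k
    unfolding a_def by (rule SB_norm_coeff_le[OF f]) simp
  note S = S_star_bounds[of q p "1 - a\<^sup>2", folded r_def, OF r1 p]
  have le: "norm (\<omega> (Suc k) q * p (Suc k)) \<le> (1 - a\<^sup>2) * r * r ^ k" for k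
  proof -
    have "norm (\<omega> (Suc k) q) \<le> r ^ Suc k"
      unfolding r_def by (rule SB_ord_norm_le) (use \<omega> r1 in \<open>auto simp: r_def\<close>)
    then have "norm (\<omega> (Suc k) q) * norm (p (Suc k)) \<le> r ^ Suc k * (1 - a\<^sup>2)"
      using r by (intro mult_mono p) auto
    then show ?thesis
      by (simp add: norm_mult mult_ac)
  qed
  have sums: "(\<lambda>k. (1 - a\<^sup>2) * r * r ^ k) sums ((1 - a\<^sup>2) * r * (1 / (1 - r)))"
    using r r1 by (intro sums_mult geometric_sums) auto
  have summable: "summable (\<lambda>k. norm (\<omega> (Suc k) q * p (Suc k)))"
    by (rule summable_comparison_test'[OF sums_summable[OF sums], of 0]) (use le in auto)
  with S(1) show "bohr_summable p \<omega> q"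
    by (simp add: bohr_summable_def r_def)
  have "(\<Sum>k. norm (\<omega> (Suc k) q * p (Suc k))) \<le> (1 - a\<^sup>2) * r * (1 / (1 - r))"
    by (rule sums_le[OF le summable_sums[OF summable] sums])
  also have "\<dots> = (1 - a\<^sup>2) * (r / (1 - r))"
    by simp
  also have "\<dots> \<le> (1 - a\<^sup>2) * (m / 2)"
  proof (rule mult_left_mono[OF _ a2])
    \<comment> \<open>The radius is exactly the solution of
      \<open>r / (1 - r) = m / 2\<close>.\<close>
    have "r * (2 + m) \<le> m"
      using r m by (simp add: pos_le_divide_eq)
    then show "r / (1 - r) \<le> m / 2"
      using r1 by (simp add: field_simps)
  qed
  finally have 1: "(\<Sum>k. norm (\<omega> (Suc k) q * p (Suc k))) \<le> (1 - a\<^sup>2) * (m / 2)" .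
  \<comment> \<open>The left side increases with \<open>r\<close>, and \<open>M_const m\<close> is
    its value at \<open>m / (2 + m)\<close>.\<close>
  have "r / (1 - r\<^sup>2) \<le> M_const m"
  proof -
    let ?R = "m / (2 + m)"
    have "r / (1 - r\<^sup>2) \<le> ?R / (1 - ?R\<^sup>2)"
    proof (rule frac_le)
      show "0 < 1 - ?R\<^sup>2"
        using power_strict_mono[OF r(3) order_trans[OF r(1,2)], of 2] by simp
      show "1 - ?R\<^sup>2 \<le> 1 - r\<^sup>2"
        using r by (intro diff_left_mono power_mono)
    qed (use r in auto)
    also have "\<dots> = M_const m"
    proof -
      have "1 - ?R\<^sup>2 = (4 * m + 4) / (2 + m)\<^sup>2"
        unfolding power_divide using m
        by (simp add: eq_divide_eq left_diff_distrib) (simp add: power2_eq_square algebra_simps)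
      then show ?thesis
        using m by (simp add: M_const_def power2_eq_square)
    qed
    finally show ?thesis .
  qed
  then have "((1 - a\<^sup>2) * (r / (1 - r\<^sup>2)))\<^sup>2 \<le> ((1 - a\<^sup>2) * M_const m)\<^sup>2"
    using a2 r r1 by (intro power_mono mult_left_mono) (auto simp: power_le_one)
  with S(3) have S_le: "S_star p q \<le> ((1 - a\<^sup>2) * M_const m)\<^sup>2"
    by linarith
  have 2: "poly (Q_poly N d) (S_star p q) \<le> (\<Sum>k=1..N. d k * (((1 - a\<^sup>2) * M_const m)\<^sup>2) ^ k)"
    unfolding poly_Q_poly using d S(2) S_le by (intro sum_mono mult_left_mono power_mono) auto
  show "bohr_sum m N d p \<omega> q \<le> 1"
    using bohr_real_inequality[OF m N d L a] 1 2 by (simp add: bohr_sum_def a_def)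
qed

section \<open>Sharpness of the radius\<close>

text \<open>The left-hand side equals 1 at \<open>a = \<rho> = 1\<close>, where its derivative in \<open>a\<close>,
  \<open>m - 2 r / (1 - r)\<close>, is negative.\<close>

lemma ex_moebius_parameters:
  fixes m r :: real
  assumes m: "0 < m" and r: "m / (2 + m) < r" "r < 1"
  obtains a \<rho> where "0 < a" "a < 1" "0 < \<rho>" "\<rho> < 1"
    "(\<rho> * a) powr m + \<rho>\<^sup>2 * (1 - a\<^sup>2) * r / (1 - a * r) > 1"
proof -
  have "0 < r"
    using m r(1) by (meson add_pos_pos divide_pos_pos less_trans zero_less_numeral)
  let ?\<psi> = "\<lambda>a. a powr m + (1 - a\<^sup>2) * r / (1 - a * r)"
  have "(?\<psi> has_real_derivative m - 2 * r / (1 - r)) (at 1)"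
    using r by (auto intro!: derivative_eq_intros)
  moreover have "m - 2 * r / (1 - r) < 0"
  proof -
    have "m < r * (2 + m)"
      using m r(1) by (simp add: pos_divide_less_eq)
    then show ?thesis
      using r(2) by (simp add: field_simps)
  qed
  ultimately obtain \<delta> where \<delta>: "\<delta> > 0" "\<And>h. 0 < h \<Longrightarrow> h < \<delta> \<Longrightarrow> ?\<psi> 1 < ?\<psi> (1 - h)"
    using DERIV_neg_dec_left by blast
  \<comment> \<open>The cap 1/2 keeps \<open>a\<close> positive.\<close>
  define a where "a = 1 - min (\<delta> / 2) (1 / 2)"
  have a: "0 < a" "a < 1" and gt: "?\<psi> a > 1"
    using \<delta>(1) \<delta>(2)[of "min (\<delta> / 2) (1 / 2)"] by (auto simp: a_def)
  \<comment> \<open>By continuity the strict inequality at \<open>\<rho> = 1\<close> persists for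
    \<open>\<rho>\<close> slightly below 1.\<close>
  have "((\<lambda>\<rho>. (\<rho> * a) powr m + \<rho>\<^sup>2 * (1 - a\<^sup>2) * r / (1 - a * r)) \<longlongrightarrow>
      (1 * a) powr m + 1\<^sup>2 * (1 - a\<^sup>2) * r / (1 - a * r)) (at_left 1)"
  proof -
    have "a * r < 1"
      using a r \<open>0 < r\<close> mult_strict_mono'[of a 1 r 1] by simp
    then show ?thesis
      using a by (intro tendsto_intros) auto
  qed
  then have "\<forall>\<^sub>F \<rho> in at_left 1. (\<rho> * a) powr m + \<rho>\<^sup>2 * (1 - a\<^sup>2) * r / (1 - a * r) > 1"
    by (rule order_tendstoD) (use gt in simp)
  moreover have "\<forall>\<^sub>F \<rho> in at_left (1::real). 0 < \<rho> \<and> \<rho> < 1"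
    by (auto simp: eventually_at_left_field intro!: exI[of _ 0])
  ultimately have "\<forall>\<^sub>F \<rho> in at_left 1.
      (\<rho> * a) powr m + \<rho>\<^sup>2 * (1 - a\<^sup>2) * r / (1 - a * r) > 1 \<and> 0 < \<rho> \<and> \<rho> < 1"
    by (rule eventually_conj)
  from eventually_happens'[OF trivial_limit_at_left_real this] a that show ?thesis
    by blast
qed

text \<open>At a positive real point the first series becomes the geometric sum of
  \<open>ex_moebius_parameters\<close>. Together with the constant term it exceeds 1, and the
  polynomial term only adds to this, whatever the nonnegative \<open>d\<close>.\<close>

lemma bohr_radius_sharp:
  assumes m: "0 < m" and d: "\<forall>i\<in>{1..N}. 0 \<le> d i" and R: "m / (2 + m) < R"
  shows "\<exists>f p \<omega> q.
    f \<in> SB \<and> has_power_series f p \<and> (\<forall>k\<ge>1. \<omega> k \<in> SB_ord k) \<and> norm q < 1 \<and> norm q \<le> R \<and>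
    bohr_summable p \<omega> q \<and> bohr_sum m N d p \<omega> q > 1"
proof -
  \<comment> \<open>The minimum keeps the witness inside the ball when \<open>R\<close> is at least
    1.\<close>
  have "m / (2 + m) < min R 1"
    using m R by simp
  then obtain r where r: "m / (2 + m) < r" "r < 1" "r \<le> R"
    using dense[of "m / (2 + m)" "min R 1"] by auto
  then have "0 < r"
    using m by (meson add_pos_pos divide_pos_pos less_trans zero_less_numeral)
  obtain a \<rho> where a: "0 < a" "a < 1" and \<rho>: "0 < \<rho>" "\<rho> < 1"
    and gt: "(\<rho> * a) powr m + \<rho>\<^sup>2 * (1 - a\<^sup>2) * r / (1 - a * r) > 1"
    using ex_moebius_parameters[OF m r(1,2)] by metis
  define f where "f q = of_real \<rho> * (of_real a - q) * inverse (1 - of_real a * q)" for q :: quat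
  define p :: "nat \<Rightarrow> quat" where
    "p k = of_real (case k of 0 \<Rightarrow> \<rho> * a | Suc j \<Rightarrow> - (\<rho> * (1 - a\<^sup>2) * a ^ j))" for k
  define \<omega> where "\<omega> k q = of_real \<rho> * q ^ k" for k and q :: quat
  define q :: quat where "q = of_real r"
  have f: "f \<in> SB" "has_power_series f p"
    unfolding f_def[abs_def] p_def[abs_def] using quat_moebius_in_SB[OF \<rho> a] by auto
  have \<omega>: "\<omega> k \<in> SB_ord k" for k
    unfolding \<omega>_def using monomial_in_SB_ord[OF \<rho>] .
  have q: "norm q = r"
    using \<open>0 < r\<close> by (simp add: q_def)
  \<comment> \<open>Any bound on the coefficients would do: only convergence and nonnegativity of
    \<open>S_star\<close> are drawn from it.\<close>
  have "norm (p (Suc k)) \<le> 1 - (norm (p 0))\<^sup>2" for k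
    by (rule SB_norm_coeff_le[OF f]) simp
  note S = S_star_bounds[of q p, OF _ this, unfolded q, OF r(2)]
  have a2: "a\<^sup>2 \<le> 1"
    using a by (simp add: power_le_one)
  have ar: "norm (a * r) < 1"
    using a r \<open>0 < r\<close> mult_strict_mono'[of a 1 r 1] by simp
  have "(\<lambda>k. \<rho>\<^sup>2 * (1 - a\<^sup>2) * r * (a * r) ^ k) sums (\<rho>\<^sup>2 * (1 - a\<^sup>2) * r * (1 / (1 - a * r)))"
    by (intro sums_mult geometric_sums ar)
  moreover have "norm (\<omega> (Suc k) q * p (Suc k)) = \<rho>\<^sup>2 * (1 - a\<^sup>2) * r * (a * r) ^ k" for k
  proof -
    have "norm (p (Suc k)) = \<rho> * (1 - a\<^sup>2) * a ^ k"
      unfolding p_def norm_of_real using \<rho> a a2 by (simp add: abs_mult)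
    then show ?thesis
      using \<rho> \<open>0 < r\<close>
      by (simp add: \<omega>_def q norm_mult norm_power power_mult_distrib power2_eq_square)
  qed
  ultimately have sums: "(\<lambda>k. norm (\<omega> (Suc k) q * p (Suc k))) sums
      (\<rho>\<^sup>2 * (1 - a\<^sup>2) * r / (1 - a * r))"
    by simp
  have summable: "bohr_summable p \<omega> q"
    using sums_summable[OF sums] S(1) by (simp add: bohr_summable_def)
  have "poly (Q_poly N d) (S_star p q) \<ge> 0"
    unfolding poly_Q_poly using d S(2) by (intro sum_nonneg mult_nonneg_nonneg) auto
  moreover have "norm (p 0) = \<rho> * a"
    unfolding p_def norm_of_real using \<rho> a by simp
  ultimately have "bohr_sum m N d p \<omega> q > 1"
    using gt by (simp add: bohr_sum_def sums_unique[OF sums, symmetric])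
  then show ?thesis
    using f \<omega> q r summable by (intro exI[of _ f] exI[of _ p] exI[of _ \<omega>] exI[of _ q]) simp
qed

text \<open>\<open>suminf\<close> says nothing about a divergent series, so both halves assert
  \<open>bohr_summable\<close> beside the inequality. The witness for sharpness is confined to the
  open ball, where the power series represents \<open>f\<close>.\<close>

theorem theorem1p6:
  fixes m :: real and N :: nat and d :: "nat \<Rightarrow> real"
  assumes "0 < m" and "m \<le> 1"
    and "1 \<le> N"
    and "\<forall>i\<in>{1..N}. 0 \<le> d i"
    and "degree (Q_poly N d) = N"
    and "L_sum m N d \<le> m"
  shows
    "(\<forall>f p \<omega> q.
        f \<in> SB \<and> has_power_series f p \<and> (\<forall>k\<ge>1. \<omega> k \<in> SB_ord k) \<and> norm q \<le> m / (2 + m) \<longrightarrow>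
        bohr_summable p \<omega> q \<and> bohr_sum m N d p \<omega> q \<le> 1) \<and>
     (\<forall>R > m / (2 + m).
        \<exists>f p \<omega> q.
          f \<in> SB \<and> has_power_series f p \<and> (\<forall>k\<ge>1. \<omega> k \<in> SB_ord k) \<and> norm q < 1 \<and> norm q \<le> R \<and>
          bohr_summable p \<omega> q \<and> bohr_sum m N d p \<omega> q > 1)"
  using bohr_inequality[OF assms(1-4,6)] bohr_radius_sharp[OF assms(1,4)] by blast

end
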